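(* Let $(\Omega,S)$ be a schurian pseudocyclic scheme of valency $k>1$ and rank greater than $2(k-1)$. Then $(\Omega,S)$ is a Frobenius scheme, and its automorphism group $\mathrm{Aut}(\Omega,S)$ is a Frobenius group.
   Context: A coherent configuration is a pair $(\Omega,S)$ where $\Omega$ is a finite set and $S$ is a partition of $\Omega\times\Omega$ such that the diagonal $1_\Omega$ is a union of elements of $S$, $S$ is closed under transposition, and for $r,s,t\in S$ the number $c_{rs}^t=|\{\beta:(\alpha,\beta)\in r,(\beta,\gamma)\in s\}|$ does not depend on $(\alpha,\gamma)\in t$. A scheme is a coherent configuration with $1_\Omega\in S$; rank is $|S|$; $S^\#=S\setminus\{1_\Omega\}$; valency $n_s=|\{\beta:(\alpha,\beta)\in s\}|$. With $\mathcal P$ the set of central primitive idempotents of the adjacency algebra $\mathbb{C}S$ (spanned by adjacency matrices), $n_P$ the dimension of an irreducible submodule of $\mathbb{C}^\Omega$ corresponding to $P$, $m_P=\operatorname{rk}(P)/n_P$ and $\mathcal P^\#=\mathcal P\setminus\{\frac1{|\Omega|}J\}$, the scheme is pseudocyclic if $m_P/n_P$ is constant on $\mathcal P^\#$; a pseudocyclic scheme has $n_s=k$ for all $s\in S^\#$ for some $k$, its valency. $\mathrm{Aut}(\Omega,S)=\{f\in\mathrm{Sym}(\Omega): s^f=s\ \forall s\in S\}$. The scheme of a transitive group $G\le\mathrm{Sym}(\Omega)$ is $(\Omega,\text{orbits of }G\text{ on }\Omega\times\Omega)$; a scheme is schurian if it is the scheme of some permutation group on $\Omega$. A Frobenius group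 is a non-regular transitive permutation group in which only the identity fixes two distinct points; a Frobenius scheme is the scheme of a Frobenius group. *)

theory Defs
  imports "HOL-Analysis.Analysis"
begin

text \<open>Point set: Omega = UNIV of a finite type 'a.  Relations are sets of pairs.\<close>

definition coherent_configuration :: "('a::finite \<times> 'a) set set \<Rightarrow> bool" where
  "coherent_configuration S \<longleftrightarrow>
     {} \<notin> S \<and> \<Union>S = UNIV \<and> (\<forall>r\<in>S. \<forall>s\<in>S. r \<noteq> s \<longrightarrow> r \<inter> s = {}) \<and>
     (\<forall>s\<in>S. s \<subseteq> Id \<or> s \<inter> Id = {}) \<and>
     (\<forall>s\<in>S. s\<inverse> \<in> S) \<and>
     (\<forall>r\<in>S. \<forall>s\<in>S. \<forall>t\<in>S. \<forall>a c a' c'. (a, c) \<in> t \<longrightarrow> (a', c') \<in> t \<longrightarrow>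
        card {b. (a, b) \<in> r \<and> (b, c) \<in> s} = card {b. (a', b) \<in> r \<and> (b, c') \<in> s})"

definition is_scheme :: "('a::finite \<times> 'a) set set \<Rightarrow> bool" where
  "is_scheme S \<longleftrightarrow> coherent_configuration S \<and> Id \<in> S"

definition valency :: "('a \<times> 'a) set \<Rightarrow> 'a \<Rightarrow> nat" where
  "valency s a = card {b. (a, b) \<in> s}"

definition adj_matrix :: "('a::finite \<times> 'a) set \<Rightarrow> complex^'a^'a" where
  "adj_matrix s = (\<chi> i j. if (i, j) \<in> s then 1 else 0)"

definition adjacency_algebra :: "('a::finite \<times> 'a) set set \<Rightarrow> (complex^'a^'a) set" where
  "adjacency_algebra S = {M. \<exists>c :: ('a \<times> 'a) set \<Rightarrow> complex.
       M = (\<chi> i j. \<Sum>s\<in>S. c s * adj_matrix s $ i $ j)}"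

definition central_idempotent :: "('a::finite \<times> 'a) set set \<Rightarrow> complex^'a^'a \<Rightarrow> bool" where
  "central_idempotent S P \<longleftrightarrow> P \<in> adjacency_algebra S \<and> P ** P = P \<and>
     (\<forall>X\<in>adjacency_algebra S. P ** X = X ** P)"

definition central_primitive_idempotents :: "('a::finite \<times> 'a) set set \<Rightarrow> (complex^'a^'a) set" where
  "central_primitive_idempotents S = {P. central_idempotent S P \<and> P \<noteq> 0 \<and>
     (\<forall>Q. central_idempotent S Q \<and> P ** Q = Q \<longrightarrow> Q = 0 \<or> Q = P)}"

definition submodule :: "('a::finite \<times> 'a) set set \<Rightarrow> (complex^'a) set \<Rightarrow> bool" where
  "submodule S V \<longleftrightarrow> vec.subspace V \<and> (\<forall>X\<in>adjacency_algebra S. \<forall>v\<in>V. X *v v \<in> V)"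

definition irreducible_submodule :: "('a::finite \<times> 'a) set set \<Rightarrow> (complex^'a) set \<Rightarrow> bool" where
  "irreducible_submodule S V \<longleftrightarrow> submodule S V \<and> V \<noteq> {0} \<and>
     (\<forall>W. submodule S W \<and> W \<subseteq> V \<longrightarrow> W = {0} \<or> W = V)"

text \<open>An irreducible submodule corresponds to P if P acts as the identity on it.\<close>
definition n_P :: "('a::finite \<times> 'a) set set \<Rightarrow> complex^'a^'a \<Rightarrow> nat" where
  "n_P S P = vec.dim (SOME V. irreducible_submodule S V \<and> (\<forall>v\<in>V. P *v v = v))"

definition m_P :: "('a::finite \<times> 'a) set set \<Rightarrow> complex^'a^'a \<Rightarrow> real" where
  "m_P S P = real (rank P) / real (n_P S P)"

definition J_normalized :: "complex^'a::finite^'a" where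
  "J_normalized = (\<chi> i j. 1 / of_nat CARD('a))"

definition pseudocyclic :: "('a::finite \<times> 'a) set set \<Rightarrow> bool" where
  "pseudocyclic S \<longleftrightarrow> is_scheme S \<and> (\<exists>c::real. \<forall>P \<in> central_primitive_idempotents S - {J_normalized}.
      m_P S P / real (n_P S P) = c)"

definition perm_group :: "('a \<Rightarrow> 'a) set \<Rightarrow> bool" where
  "perm_group G \<longleftrightarrow> (\<forall>g\<in>G. bij g) \<and> id \<in> G \<and> (\<forall>f\<in>G. \<forall>g\<in>G. f \<circ> g \<in> G) \<and> (\<forall>g\<in>G. inv g \<in> G)"

definition transitive_group :: "('a \<Rightarrow> 'a) set \<Rightarrow> bool" where
  "transitive_group G \<longleftrightarrow> perm_group G \<and> (\<forall>x y. \<exists>g\<in>G. g x = y)"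

definition frobenius_group :: "('a \<Rightarrow> 'a) set \<Rightarrow> bool" where
  "frobenius_group G \<longleftrightarrow> transitive_group G \<and>
     \<not> (\<forall>g\<in>G. \<forall>x. g x = x \<longrightarrow> g = id) \<and>
     (\<forall>g\<in>G. \<forall>x y. x \<noteq> y \<and> g x = x \<and> g y = y \<longrightarrow> g = id)"

definition orbitals :: "('a \<Rightarrow> 'a) set \<Rightarrow> ('a \<times> 'a) set set" where
  "orbitals G = {{(g x, g y) | g. g \<in> G} | x y. True}"

definition scheme_of_group :: "('a \<Rightarrow> 'a) set \<Rightarrow> ('a \<times> 'a) set set \<Rightarrow> bool" where
  "scheme_of_group G S \<longleftrightarrow> transitive_group G \<and> S = orbitals G"

definition schurian :: "('a::finite \<times> 'a) set set \<Rightarrow> bool" where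
  "schurian S \<longleftrightarrow> (\<exists>G. perm_group G \<and> S = orbitals G)"

definition frobenius_scheme :: "('a::finite \<times> 'a) set set \<Rightarrow> bool" where
  "frobenius_scheme S \<longleftrightarrow> (\<exists>G. frobenius_group G \<and> scheme_of_group G S)"

definition Aut :: "('a \<times> 'a) set set \<Rightarrow> ('a \<Rightarrow> 'a) set" where
  "Aut S = {f. bij f \<and> (\<forall>s\<in>S. (\<lambda>(x, y). (f x, f y)) ` s = s)}"

end

theory Submission
  imports Defs "HOL-Computational_Algebra.Fundamental_Theorem_Algebra"
begin

text \<open>
  Let \<open>G\<close> be the automorphism group of the scheme, so that \<open>S\<close> consists of the orbitals of \<open>G\<close> and the
  adjacency algebra \<open>A\<close> is the algebra of \<open>G\<close>-invariant matrices.  For an irreducible \<open>A\<close>-module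
  \<open>V\<close> of dimension \<open>d\<close>, averaging the orthogonal projection \<open>E\<close> onto \<open>V\<close> over \<open>G\<close> gives \<open>\<nu>\<close> times the
  central primitive idempotent \<open>P\<close> of \<open>V\<close>; comparing traces, \<open>\<nu> d = |G| n_P / m_P\<close>.  On the other
  hand, by Schur's lemma, the central element \<open>\<Sum>\<^sub>g fix(g) g\<close> of the group algebra acts on \<open>V\<close> as \<open>\<nu> d\<close>.
  Pseudocyclicity thus says that this element is a combination of the identity and the all-one
  matrix, that is, the sum of \<open>fix(g)\<close> over all \<open>g\<close> mapping \<open>a\<close> to \<open>b\<close> is the same for all \<open>a \<noteq> b\<close>.

  If \<open>h\<close> is the order of a two-point stabilizer, counting shows that this sum is \<open>h (k - 1)\<close>.  Each
  fixed point of a given \<open>g\<close> with \<open>g a = b\<close> contributes \<open>h\<close> to it, so a nonidentity \<open>g\<close> has at most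
  \<open>k - 1\<close> fixed points.  Counting the orbits of a point stabilizer by Burnside's lemma then contradicts the
  bound on the rank unless \<open>h = 1\<close>.
\<close>

section \<open>Linear algebra over the complex numbers\<close>

text \<open>The n + 1 vectors v, Xv, ..., X^n v lie in a space of dimension n. Linear dependence is
  a property of sets, so it yields a relation only when these vectors are distinct; a repetition is
  itself a relation. The degree bound ensures that the truncated sum sees every coefficient of
  p.\<close>

lemma exists_annihilating_poly:
  fixes X :: "'b::field^'n^'n"
  shows "\<exists>p. p \<noteq> 0 \<and> degree p \<le> CARD('n) \<and>
    (\<Sum>i\<le>CARD('n). coeff p i *s ((*v) X ^^ i) v) = 0"
proof -
  let ?f = "\<lambda>i. ((*v) X ^^ i) v"
  have "\<exists>c. (\<exists>i\<le>CARD('n). c i \<noteq> 0) \<and> (\<Sum>i\<le>CARD('n). c i *s ?f i) = 0"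
  proof (cases "inj_on ?f {..CARD('n)}")
    case True
    then have "card (?f ` {..CARD('n)}) = Suc (CARD('n))"
      by (simp add: card_image)
    moreover have "vec.dim (?f ` {..CARD('n)}) \<le> CARD('n)"
      using vec.dim_subset[OF subset_UNIV, of "?f ` {..CARD('n)}"] unfolding vec_dim_card .
    ultimately have "vec.dependent (?f ` {..CARD('n)})"
      by (intro vec.dependent_biggerset_general) simp
    then obtain u where u: "\<exists>v\<in>?f ` {..CARD('n)}. u v \<noteq> 0"
        "(\<Sum>v\<in>?f ` {..CARD('n)}. u v *s v) = 0"
      using vec.dependent_finite[of "?f ` {..CARD('n)}"] by auto
    then have "(\<Sum>i\<le>CARD('n). u (?f i) *s ?f i) = 0"
      by (simp add: sum.reindex[OF True] o_def)
    with u(1) show ?thesis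
      by (intro exI[of _ "\<lambda>i. u (?f i)"]) auto
  next
    case False
    then obtain i j where ij: "i \<le> CARD('n)" "j \<le> CARD('n)" "i \<noteq> j" "?f i = ?f j"
      unfolding inj_on_def by auto
    have "(\<Sum>l\<le>CARD('n). ((if l = i then 1 else 0) - (if l = j then 1 else 0)) *s ?f l)
      = (\<Sum>l\<le>CARD('n). if l = i then ?f l else 0) - (\<Sum>l\<le>CARD('n). if l = j then ?f l else 0)"
      unfolding sum_subtractf[symmetric]
      by (intro sum.cong) (auto simp: vec.scale_left_diff_distrib)
    also have "\<dots> = 0"
      using ij by simp
    finally show ?thesis
      using ij by (intro exI[of _ "\<lambda>l. (if l = i then 1 else 0) - (if l = j then 1 else 0)"]) auto
  qed
  then obtain c i where c: "i \<le> CARD('n)" "c i \<noteq> 0" "(\<Sum>i\<le>CARD('n). c i *s ?f i) = 0"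
    by blast
  define p where "p = (\<Sum>i\<le>CARD('n). monom (c i) i)"
  have coeff: "coeff p l = (if l \<le> CARD('n) then c l else 0)" for l
    by (simp add: p_def coeff_sum sum.delta' if_distrib[of "\<lambda>x. x = l"])
  have "p \<noteq> 0"
    using c(1,2) coeff[of i] by auto
  moreover have "degree p \<le> CARD('n)"
    by (rule degree_le) (simp add: coeff)
  ultimately show ?thesis
    using c(3) by (intro exI[of _ p]) (simp add: coeff)
qed

text \<open>Take a polynomial p of least degree that annihilates some nonzero v in V, and split off
  a root z, so that p = (x - z) q. By minimality q(X) v is nonzero, and X - z sends it to p(X) v =
  0. In the proof \<open>e p\<close> stands for p(X) v.\<close>

lemma eigenvector_in_invariant_subspace:
  fixes X :: "complex^'n^'n"
  assumes V: "vec.subspace V" and ne: "V \<noteq> {0}" and inv: "\<And>v. v \<in> V \<Longrightarrow> X *v v \<in> V"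
  shows "\<exists>z w. w \<in> V \<and> w \<noteq> 0 \<and> X *v w = z *s w"
proof -
  obtain v where v: "v \<in> V" "v \<noteq> 0"
    using ne vec.subspace_0[OF V] by auto
  let ?f = "\<lambda>i. ((*v) X ^^ i) v"
  define e where "e p = (\<Sum>i\<le>CARD('n). coeff p i *s ?f i)" for p
  let ?P = "\<lambda>p. p \<noteq> 0 \<and> degree p \<le> CARD('n) \<and> e p = 0"
  obtain p where p: "?P p" and min: "\<And>q. ?P q \<Longrightarrow> degree p \<le> degree q"
    using exists_annihilating_poly[of X v] unfolding e_def[symmetric]
    by (metis exists_least_iff[of "\<lambda>n. \<exists>p. ?P p \<and> degree p = n"] not_le)
  have f_V: "?f i \<in> V" for i
    by (induction i) (auto simp: v inv)
  have e_V: "e q \<in> V" for q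
    unfolding e_def by (intro vec.subspace_sum vec.subspace_scale V f_V)
  have "degree p \<noteq> 0"
  proof
    assume "degree p = 0"
    then obtain a where a: "p = [:a:]" by (metis degree_eq_zeroE)
    then have "e p = (\<Sum>i\<le>CARD('n). if i = 0 then a *s v else 0)"
      unfolding e_def by (intro sum.cong) (auto simp: coeff_pCons split: nat.split)
    then have "e p = a *s v" by simp
    with p v a show False by auto
  qed
  then obtain z where z: "poly p z = 0"
    using fundamental_theorem_of_algebra[of p] constant_degree[of p] by auto
  then obtain q where q: "p = [:-z, 1:] * q"
    by (auto simp: poly_eq_0_iff_dvd)
  have q0: "q \<noteq> 0" using p q by auto
  have deg: "degree p = Suc (degree q)"
    unfolding q by (subst degree_mult_eq) (use q0 in auto)
  obtain m where m: "CARD('n) = Suc m"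
    using gr0_conv_Suc zero_less_card_finite by blast
  have nz: "e q \<noteq> 0"
    using min[of q] p deg q0 by auto
  \<comment> \<open>Multiplication by X shifts indices upwards; since the top coefficient of q
    vanishes, nothing is pushed beyond the range of the sum in \<open>e\<close>.\<close>
  have "coeff q (Suc m) = 0"
    using deg p m by (intro coeff_eq_0) simp
  then have "X *v e q = (\<Sum>i\<le>m. coeff q i *s ?f (Suc i))"
    unfolding e_def m by (simp add: matrix_vector_right_distrib vec.linear_sum[OF matrix_vector_mul_linear_gen]
        vec.scale)
  also have "\<dots> = e (pCons 0 q)"
    unfolding e_def m sum.atMost_Suc_shift by simp
  also have "\<dots> = e p + z *s e q"
    unfolding q e_def by (simp add: vec.scale_sum_right sum.distrib[symmetric] vec.scale_left_diff_distrib)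
  finally have "X *v e q = z *s e q"
    using p by simp
  with nz e_V show ?thesis by blast
qed

text \<open>Expand each E x in a basis B of the image. Reassembling the diagonal entries of E by
  linearity gives the sum over b in B of the b-coordinate of E b = b, which is 1 for each b.\<close>

lemma trace_idempotent:
  fixes E :: "'b::field^'n^'n"
  assumes "E ** E = E"
  shows "trace E = of_nat (vec.dim (range ((*v) E)))"
proof -
  let ?V = "range ((*v) E)"
  obtain B where B: "B \<subseteq> ?V" "vec.independent B" "?V \<subseteq> vec.span B" "card B = vec.dim ?V"
    using vec.basis_exists by blast
  have fin: "finite B" using B(2) vec.finiteI_independent by blast
  have EE: "E *v (E *v x) = E *v x" for x
    using assms by (simp add: matrix_vector_mul_assoc)
  have EB: "E *v b = b" if "b \<in> B" for b
    using that B(1) EE by auto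
  have E_sp: "E *v x \<in> vec.span B" for x
    using B(3) by auto
  let ?r = "\<lambda>x. vec.representation B (E *v x)"
  have rep: "(\<Sum>b\<in>B. ?r x b *s b) = E *v x" for x
    by (rule vec.sum_representation_eq) (use B(2) E_sp fin in auto)
  have lin: "?r b b = (\<Sum>i\<in>UNIV. b $ i * ?r (axis i 1) b)" for b
  proof -
    have "E *v b = E *v (\<Sum>i\<in>UNIV. b $ i *s axis i 1)"
      by (simp add: basis_expansion)
    also have "\<dots> = (\<Sum>i\<in>UNIV. b $ i *s (E *v axis i 1))"
      by (simp add: vec.linear_sum[OF matrix_vector_mul_linear_gen] vec.scale)
    finally show ?thesis
      using B(2) E_sp by (simp add: vec.representation_sum vec.representation_scale vec.span_scale)
  qed
  have "trace E = (\<Sum>i\<in>UNIV. (E *v axis i 1) $ i)"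
    unfolding trace_def by (simp add: matrix_vector_mul_component matrix_vector_mult_def axis_def if_distrib cong: if_cong)
  also have "\<dots> = (\<Sum>i\<in>UNIV. \<Sum>b\<in>B. ?r (axis i 1) b * b $ i)"
    by (subst rep[symmetric]) simp
  also have "\<dots> = (\<Sum>b\<in>B. ?r b b)"
    by (subst sum.swap) (simp add: lin mult.commute)
  also have "\<dots> = (\<Sum>b\<in>B. 1)"
    by (intro sum.cong) (auto simp: EB vec.representation_basis[OF B(2)])
  finally show ?thesis using B(4) by simp
qed

text \<open>The rank is defined through the row space, which is the image of the transpose, again an
  idempotent with the same trace.\<close>

lemma trace_idempotent_rank:
  fixes E :: "'b::field^'n^'n"
  assumes "E ** E = E"
  shows "trace E = of_nat (rank E)"
proof -
  let ?T = "transpose E"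
  have "range ((*v) ?T) \<subseteq> vec.span (columns ?T)"
    by (auto simp: matrix_vector_mult_in_columnspace_gen simp del: transpose_matrix_vector columns_transpose)
  moreover have "columns ?T \<subseteq> range ((*v) ?T)"
  proof
    fix y assume "y \<in> columns ?T"
    then obtain i where "y = column i ?T" unfolding columns_def by auto
    also have "\<dots> = ?T *v axis i 1"
      by (simp add: vec_eq_iff matrix_vector_mult_def column_def axis_def if_distrib
          del: transpose_matrix_vector column_transpose cong: if_cong)
    finally show "y \<in> range ((*v) ?T)" by blast
  qed
  ultimately have "vec.dim (range ((*v) ?T)) = vec.dim (columns ?T)"
    by (meson vec.dim_mono vec.dim_subset order_antisym)
  then have "vec.dim (range ((*v) ?T)) = rank E"
    by (simp add: row_rank_def_gen columns_transpose)
  moreover have "?T ** ?T = ?T"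
    using assms by (metis matrix_transpose_mul)
  then have "trace ?T = of_nat (vec.dim (range ((*v) ?T)))"
    by (rule trace_idempotent)
  moreover have "trace ?T = trace E"
    by (simp add: trace_def transpose_def)
  ultimately show ?thesis by simp
qed

text \<open>Here \<open>orthogonal\<close> refers to the real inner product, the real part of the
  Hermitian one. For a complex subspace both give the same orthogonal complement, which is why the
  projection is complex linear.\<close>

lemma orthogonal_projection_matrix:
  fixes V :: "(complex^'n) set"
  assumes V: "vec.subspace V"
  obtains E where "\<And>x. E *v x \<in> V" "\<And>x v. v \<in> V \<Longrightarrow> orthogonal (x - E *v x) v"
    "\<And>x y. y \<in> V \<Longrightarrow> (\<And>v. v \<in> V \<Longrightarrow> orthogonal (x - y) v) \<Longrightarrow> E *v x = y"
proof -
  have scaleR: "r *\<^sub>R x = complex_of_real r *s x" for r and x :: "complex^'n"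
    unfolding vec_eq_iff by (simp add: complex_eq_iff)
  have sub: "subspace V"
    unfolding subspace_def scaleR
    using V vec.subspace_0 vec.subspace_add vec.subspace_scale by blast
  have "\<forall>x. \<exists>y. y \<in> V \<and> (\<forall>v\<in>V. orthogonal (x - y) v)"
  proof
    fix x
    obtain y z where "y \<in> span V" "\<And>w. w \<in> span V \<Longrightarrow> orthogonal z w" "x = y + z"
      using orthogonal_subspace_decomp_exists[of V x] by blast
    then show "\<exists>y. y \<in> V \<and> (\<forall>v\<in>V. orthogonal (x - y) v)"
      unfolding span_eq_iff[THEN iffD2, OF sub] by (intro exI[of _ y]) auto
  qed
  then obtain p where p: "\<And>x. p x \<in> V" "\<And>x v. v \<in> V \<Longrightarrow> orthogonal (x - p x) v"
    by metis
  have uniq: "p x = y" if "y \<in> V" "\<And>v. v \<in> V \<Longrightarrow> orthogonal (x - y) v" for x y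
  proof -
    have d: "p x - y \<in> V" using p that sub by (simp add: subspace_diff)
    have "orthogonal ((x - y) - (x - p x)) (p x - y)"
      using that(2)[OF d] p(2)[OF d] by (rule orthogonal_clauses)
    then show ?thesis by (simp add: orthogonal_def)
  qed
  \<comment> \<open>The scalar c moves to the other argument as its conjugate, and V absorbs it
    there.\<close>
  have orth_scale: "orthogonal (c *s x) v" if "\<And>v. v \<in> V \<Longrightarrow> orthogonal x v" "v \<in> V" for c x v
  proof -
    have "inner (c *s x) v = inner x (cnj c *s v)"
      by (simp add: inner_vec_def inner_complex_def algebra_simps)
    moreover have "cnj c *s v \<in> V" using that V vec.subspace_scale by blast
    ultimately show ?thesis using that by (simp add: orthogonal_def)
  qed
  have p_add: "p (x + y) = p x + p y" for x y
  proof (rule uniq)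
    show "p x + p y \<in> V" using p sub by (simp add: subspace_add)
    fix v assume "v \<in> V"
    then have "orthogonal ((x - p x) + (y - p y)) v"
      by (simp only: orthogonal_def inner_add_left p(2)[unfolded orthogonal_def])
    then show "orthogonal (x + y - (p x + p y)) v" by (simp add: algebra_simps)
  qed
  have p_scale: "p (c *s x) = c *s p x" for c x
  proof (rule uniq)
    show "c *s p x \<in> V" using p V vec.subspace_scale by blast
    fix v assume "v \<in> V"
    then have "orthogonal (c *s (x - p x)) v"
      using p orth_scale[of "x - p x" v c] by blast
    then show "orthogonal (c *s x - c *s p x) v" by (simp add: vec.scale_right_diff_distrib)
  qed
  have "Vector_Spaces.linear (*s) (*s) p"
    by unfold_locales (simp_all add: p_add p_scale)
  then have "matrix p *v x = p x" for x by (rule matrix_works)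
  with p uniq show ?thesis by (intro that[of "matrix p"]) auto
qed

section \<open>Scalar multiples, written \<open>mat c ** M\<close>, and finite sums of
  matrices\<close>

lemma mat_mult_vector: "(mat c ** M) *v x = c *s (M *v x)" for M :: "'b::field^'n^'m"
  by (simp add: matrix_vector_mul_assoc[symmetric] vec_eq_iff)
     (simp add: matrix_vector_mult_def mat_def if_distrib if_distribR cong: if_cong)

lemma mat_mult_component: "(mat c ** M) $ i $ j = c * M $ i $ j" for M :: "'b::field^'n^'m"
  by (simp add: matrix_matrix_mult_def mat_def if_distrib if_distribR cong: if_cong)

lemma mat_mult_commute: "M ** mat c = mat c ** M" for M :: "'b::field^'n^'n"
  unfolding vec_eq_iff mat_mult_component
  by (simp add: matrix_matrix_mult_def mat_def if_distrib if_distribR mult.commute cong: if_cong)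

lemma matrix_mul_sum_right: "M ** (\<Sum>i\<in>I. f i) = (\<Sum>i\<in>I. M ** f i)" for M :: "'b::field^'n^'m"
  by (induction I rule: infinite_finite_induct) (auto simp: matrix_add_ldistrib)

lemma matrix_vector_sum_left: "(\<Sum>i\<in>I. f i) *v x = (\<Sum>i\<in>I. f i *v x)" for x :: "'b::field^'n"
  by (induction I rule: infinite_finite_induct) (auto simp: matrix_vector_mult_add_rdistrib)

lemma matrix_vector_sum_right: "M *v (\<Sum>i\<in>I. f i) = (\<Sum>i\<in>I. M *v f i)" for M :: "'b::field^'n^'m"
  by (induction I rule: infinite_finite_induct) (auto simp: matrix_vector_right_distrib)

lemma matrix_mul_sum_left: "(\<Sum>i\<in>I. f i) ** M = (\<Sum>i\<in>I. f i ** M)" for M :: "'b::field^'n^'m"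
  by (simp add: matrix_eq matrix_vector_mul_assoc[symmetric] matrix_vector_sum_left)

lemma inner_vec_complex: "inner x y = Re (\<Sum>i\<in>UNIV. x $ i * cnj (y $ i))" for x y :: "complex^'n"
  by (simp add: inner_vec_def inner_complex_def)

section \<open>Permutation groups and invariant matrices\<close>

lemma perm_groupD:
  assumes "perm_group G"
  shows "g \<in> G \<Longrightarrow> bij g" "id \<in> G" "f \<in> G \<Longrightarrow> g \<in> G \<Longrightarrow> f \<circ> g \<in> G" "g \<in> G \<Longrightarrow> inv g \<in> G"
    "g \<in> G \<Longrightarrow> inv g (g x) = x" "g \<in> G \<Longrightarrow> g (inv g x) = x"
  using assms unfolding perm_group_def
  by (auto simp: bij_is_inj bij_is_surj surj_f_inv_f)

definition orbital :: "('a \<Rightarrow> 'a) set \<Rightarrow> 'a \<Rightarrow> 'a \<Rightarrow> ('a \<times> 'a) set" where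
  "orbital G x y = {(g x, g y) | g. g \<in> G}"

lemma orbitals_eq: "orbitals G = {orbital G x y | x y. True}"
  unfolding orbitals_def orbital_def ..

lemma orbital_unique:
  assumes G: "perm_group G" and "s \<in> orbitals G" "(a, b) \<in> s"
  shows "s = orbital G a b"
proof -
  obtain x y where s: "s = orbital G x y" using assms unfolding orbitals_eq by auto
  then obtain g where g: "g \<in> G" "a = g x" "b = g y"
    using assms(3) unfolding orbital_def by auto
  have "\<exists>h'. (h x, h y) = (h' (g x), h' (g y)) \<and> h' \<in> G" if "h \<in> G" for h
    using g that by (intro exI[of _ "h \<circ> inv g"]) (auto simp: perm_groupD[OF G])
  moreover have "\<exists>h'. (h (g x), h (g y)) = (h' x, h' y) \<and> h' \<in> G" if "h \<in> G" for h
    using g that by (intro exI[of _ "h \<circ> g"]) (auto simp: perm_groupD[OF G])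
  ultimately show ?thesis
    unfolding s orbital_def g by auto
qed

lemma mem_orbital_self: "perm_group G \<Longrightarrow> (a, b) \<in> orbital G a b"
  unfolding orbital_def using perm_groupD(2) by (intro CollectI exI[of _ id]) auto

text \<open>With this convention (\<open>perm_matrix g\<close> *v v) has entry v at g i in position
  i, so composition is reversed: \<open>perm_matrix g ** perm_matrix h\<close> is the matrix of
  \<open>h \<circ> g\<close>.\<close>

definition perm_matrix :: "('a::finite \<Rightarrow> 'a) \<Rightarrow> complex^'a^'a" where
  "perm_matrix g = (\<chi> i j. if g i = j then 1 else 0)"

lemma perm_matrix_mul_left: "(perm_matrix g ** M) $ i $ j = M $ g i $ j"
  by (simp add: perm_matrix_def matrix_matrix_mult_def if_distrib if_distribR cong: if_cong)

lemma perm_matrix_mul_right: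
  assumes "bij g"
  shows "(M ** perm_matrix g) $ i $ j = M $ i $ inv g j"
proof -
  have eq: "g k = j \<longleftrightarrow> k = inv g j" for k
    using assms by (metis bij_inv_eq_iff)
  show ?thesis
    by (simp add: perm_matrix_def matrix_matrix_mult_def eq if_distrib if_distribR cong: if_cong)
qed

section \<open>The adjacency algebra as an algebra of invariant matrices, and its commutant\<close>

locale group_scheme =
  fixes G :: "('a::finite \<Rightarrow> 'a) set" and S :: "('a \<times> 'a) set set"
  assumes G: "perm_group G" and S: "S = orbitals G"
begin

abbreviation "A \<equiv> adjacency_algebra S"

lemma mem_algebra_iff: "M \<in> A \<longleftrightarrow> (\<forall>g\<in>G. \<forall>a b. M $ g a $ g b = M $ a $ b)"
proof
  assume "M \<in> A"
  then obtain c where M: "M = (\<chi> i j. \<Sum>s\<in>S. c s * adj_matrix s $ i $ j)"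
    unfolding adjacency_algebra_def by blast
  have "(g a, g b) \<in> s \<longleftrightarrow> (a, b) \<in> s" if "g \<in> G" "s \<in> S" for g a b s
  proof
    assume "(a, b) \<in> s"
    with that show "(g a, g b) \<in> s"
      using orbital_unique[OF G] unfolding S orbital_def by fastforce
  next
    assume "(g a, g b) \<in> s"
    then have "s = orbital G (g a) (g b)" using that orbital_unique[OF G] S by blast
    moreover have "(inv g (g a), inv g (g b)) \<in> orbital G (g a) (g b)"
      unfolding orbital_def using that perm_groupD[OF G] by blast
    ultimately show "(a, b) \<in> s" using that by (simp add: perm_groupD[OF G])
  qed
  then show "\<forall>g\<in>G. \<forall>a b. M $ g a $ g b = M $ a $ b"
    unfolding M adj_matrix_def by simp
next
  assume inv: "\<forall>g\<in>G. \<forall>a b. M $ g a $ g b = M $ a $ b"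
  \<comment> \<open>An invariant matrix is constant on each orbital, so its entry at any chosen pair
    of s serves as the coefficient of s.\<close>
  define c where "c s = (let p = SOME p. p \<in> s in M $ fst p $ snd p)" for s
  have c: "c (orbital G i j) = M $ i $ j" for i j
  proof -
    have "(SOME p. p \<in> orbital G i j) \<in> orbital G i j"
      using mem_orbital_self[OF G] by (rule someI)
    then show ?thesis
      using inv unfolding c_def orbital_def Let_def by auto
  qed
  have "M $ i $ j = (\<Sum>s\<in>S. c s * adj_matrix s $ i $ j)" for i j
  proof -
    have "(i, j) \<in> s \<longleftrightarrow> s = orbital G i j" if "s \<in> S" for s
      using that orbital_unique[OF G, of s i j] mem_orbital_self[OF G, of i j] S by blast
    then have "(\<Sum>s\<in>S. c s * adj_matrix s $ i $ j) = (\<Sum>s\<in>S. if s = orbital G i j then c s else 0)"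
      by (intro sum.cong) (simp_all add: adj_matrix_def)
    also have "\<dots> = c (orbital G i j)"
      by (simp add: S orbitals_eq) blast
    finally show ?thesis using c by simp
  qed
  then show "M \<in> A"
    unfolding adjacency_algebra_def by (intro CollectI exI[of _ c]) (simp add: vec_eq_iff)
qed

lemma algebra_invariant: "M \<in> A \<Longrightarrow> g \<in> G \<Longrightarrow> M $ g a $ g b = M $ a $ b"
  unfolding mem_algebra_iff by blast

lemma algebraI: "(\<And>g a b. g \<in> G \<Longrightarrow> M $ g a $ g b = M $ a $ b) \<Longrightarrow> M \<in> A"
  unfolding mem_algebra_iff by blast

text \<open>These are the endomorphisms of the standard module. They include the permutation
  matrices of G, and those that lie in A as well form the center of A.\<close>

definition commutant :: "(complex^'a^'a) set" where
  "commutant = {X. \<forall>M\<in>A. X ** M = M ** X}"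

lemma commutantD: "X \<in> commutant \<Longrightarrow> M \<in> A \<Longrightarrow> X ** M = M ** X"
  unfolding commutant_def by blast

lemma commutant_vector: "X \<in> commutant \<Longrightarrow> M \<in> A \<Longrightarrow> M *v (X *v v) = X *v (M *v v)"
  by (simp add: matrix_vector_mul_assoc commutantD)

lemma commutant_mult: "X \<in> commutant \<Longrightarrow> Y \<in> commutant \<Longrightarrow> X ** Y \<in> commutant"
  unfolding commutant_def mem_Collect_eq by (metis matrix_mul_assoc)

lemma commutant_mat: "mat c \<in> commutant"
  unfolding commutant_def by (simp add: mat_mult_commute)

lemma commutant_diff: "X \<in> commutant \<Longrightarrow> Y \<in> commutant \<Longrightarrow> X - Y \<in> commutant"
  unfolding commutant_def by (auto simp: matrix_eq matrix_vector_mult_diff_distrib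
      matrix_vector_mult_diff_rdistrib matrix_vector_mul_assoc[symmetric])

lemma commutant_sum: "(\<And>i. i \<in> I \<Longrightarrow> f i \<in> commutant) \<Longrightarrow> sum f I \<in> commutant"
  unfolding commutant_def by (simp add: matrix_mul_sum_left matrix_mul_sum_right)

lemma commutant_perm_matrix:
  assumes g: "g \<in> G"
  shows "perm_matrix g \<in> commutant"
  unfolding commutant_def
proof (intro CollectI ballI)
  fix M assume "M \<in> A"
  then have "M $ g i $ g (inv g j) = M $ i $ inv g j" for i j
    using g by (rule algebra_invariant)
  then show "perm_matrix g ** M = M ** perm_matrix g"
    using g by (simp add: vec_eq_iff perm_matrix_mul_left perm_matrix_mul_right perm_groupD[OF G])
qed

lemma algebra_mult:
  assumes "M \<in> A" "N \<in> A"
  shows "M ** N \<in> A"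
proof (rule algebraI)
  fix g a b assume g: "g \<in> G"
  have "(\<Sum>k\<in>UNIV. M $ g a $ g k * N $ g k $ g b) = (\<Sum>k\<in>UNIV. M $ g a $ k * N $ k $ g b)"
    by (rule sum.reindex_bij_betw[OF perm_groupD(1)[OF G g]])
  then show "(M ** N) $ g a $ g b = (M ** N) $ a $ b"
    by (simp add: matrix_matrix_mult_def algebra_invariant[OF assms(1) g] algebra_invariant[OF assms(2) g])
qed

lemma algebra_mat: "mat c \<in> A"
  by (rule algebraI) (auto simp: mat_def dest: perm_groupD(1)[OF G] bij_is_inj injD)

section \<open>Submodules, Schur's lemma and complete reducibility\<close>

lemma submodule_image:
  assumes "submodule S V" "X \<in> commutant"
  shows "submodule S ((*v) X ` V)"
  unfolding submodule_def
proof (intro conjI ballI)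
  show "vec.subspace ((*v) X ` V)"
    using assms(1) unfolding submodule_def by (intro vec.linear_subspace_image) auto
  fix M x assume "M \<in> A" "x \<in> (*v) X ` V"
  then show "M *v x \<in> (*v) X ` V"
    using assms commutant_vector[OF assms(2)] unfolding submodule_def by fastforce
qed

lemma submodule_eigenspace:
  assumes "submodule S V" "X \<in> commutant"
  shows "submodule S {v \<in> V. X *v v = c *s v}"
  using assms unfolding submodule_def vec.subspace_def
  by (auto simp: matrix_vector_right_distrib vec.scale_right_distrib vector_scalar_commute
      commutant_vector[symmetric] vec.scale_left_commute)

lemma submodule_kernel:
  assumes "submodule S V" "X \<in> commutant"
  shows "submodule S {v \<in> V. X *v v = 0}"
  using submodule_eigenspace[OF assms, of 0] by simp

lemma submodule_UNIV: "submodule S UNIV"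
  unfolding submodule_def by auto

lemma contains_irreducible:
  assumes "submodule S V" "V \<noteq> {0}"
  obtains W where "irreducible_submodule S W" "W \<subseteq> V"
proof -
  let ?P = "\<lambda>W. submodule S W \<and> W \<noteq> {0} \<and> W \<subseteq> V"
  obtain W where W: "?P W" and min: "\<And>U. ?P U \<Longrightarrow> vec.dim W \<le> vec.dim U"
    using ex_has_least_nat[of ?P V vec.dim] assms by blast
  have "U = {0} \<or> U = W" if U: "submodule S U" "U \<subseteq> W" for U
  proof (cases "U = {0}")
    case False
    then have "vec.dim W \<le> vec.dim U" using U W by (intro min) blast
    then show ?thesis
      using U W vec.subspace_dim_equal[of U W] unfolding submodule_def by blast
  qed simp
  with W show ?thesis
    by (intro that[of W]) (auto simp: irreducible_submodule_def)
qed

lemma irreducible_nonzero: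
  assumes "irreducible_submodule S W"
  obtains w where "w \<in> W" "w \<noteq> 0"
proof -
  have "0 \<in> W" "W \<noteq> {0}"
    using assms vec.subspace_0 unfolding irreducible_submodule_def submodule_def by auto
  then show ?thesis using that by blast
qed

text \<open>X has an eigenvector in V, and the corresponding eigenspace within V is a nonzero
  submodule, hence all of V.\<close>

lemma schur_scalar:
  assumes V: "irreducible_submodule S V" and X: "X \<in> commutant" and inv: "\<And>v. v \<in> V \<Longrightarrow> X *v v \<in> V"
  shows "\<exists>c. \<forall>v\<in>V. X *v v = c *s v"
proof -
  have sub: "submodule S V" "V \<noteq> {0}" using V unfolding irreducible_submodule_def by auto
  then obtain c w where w: "w \<in> V" "w \<noteq> 0" "X *v w = c *s w"
    using eigenvector_in_invariant_subspace[of V X] inv unfolding submodule_def by blast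
  let ?W = "{v \<in> V. X *v v = c *s v}"
  have "?W = {0} \<or> ?W = V"
    using V submodule_eigenspace[OF sub(1) X, of c] unfolding irreducible_submodule_def by blast
  with w show ?thesis by blast
qed

lemma schur_iso:
  assumes V: "irreducible_submodule S V" and W: "irreducible_submodule S W" and X: "X \<in> commutant"
    and into: "\<And>w. w \<in> W \<Longrightarrow> X *v w \<in> V" and nz: "w0 \<in> W" "X *v w0 \<noteq> 0"
  shows "vec.dim W = vec.dim V" "\<And>w. w \<in> W \<Longrightarrow> X *v w = 0 \<Longrightarrow> w = 0"
proof -
  have sub: "submodule S W" "submodule S V"
    using V W unfolding irreducible_submodule_def by auto
  have "{w \<in> W. X *v w = 0} = {0} \<or> {w \<in> W. X *v w = 0} = W"
    using W submodule_kernel[OF sub(1) X] unfolding irreducible_submodule_def by blast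
  then show inj: "\<And>w. w \<in> W \<Longrightarrow> X *v w = 0 \<Longrightarrow> w = 0"
    using nz by blast
  have "(*v) X ` W = {0} \<or> (*v) X ` W = V"
    using V submodule_image[OF sub(1) X] into unfolding irreducible_submodule_def by blast
  then have im: "(*v) X ` W = V" using nz by blast
  have subW: "vec.subspace W" using sub unfolding submodule_def by blast
  have "inj_on ((*v) X) W"
  proof (rule inj_onI)
    fix x y assume "x \<in> W" "y \<in> W" "X *v x = X *v y"
    then show "x = y"
      using inj[of "x - y"] vec.subspace_diff[OF subW] by (simp add: matrix_vector_mult_diff_distrib)
  qed
  then have "inj_on ((*v) X) (vec.span W)"
    using subW by (metis vec.span_eq_iff)
  then have "vec.dim ((*v) X ` W) = vec.dim W"
    by (intro vec.dim_image_eq) auto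
  with im show "vec.dim W = vec.dim V" by simp
qed

text \<open>A is closed under conjugate transposition. Hence for M in A the vector M x - M E x stays
  orthogonal to V, while M E x lies in V; uniqueness of the projection then gives E M = M E.\<close>

lemma commuting_projection:
  assumes V: "submodule S V"
  obtains E where "E \<in> commutant" "E ** E = E" "\<And>x. E *v x \<in> V" "\<And>v. v \<in> V \<Longrightarrow> E *v v = v"
proof -
  have sub: "vec.subspace V" using V unfolding submodule_def by blast
  obtain E where E: "\<And>x. E *v x \<in> V" "\<And>x v. v \<in> V \<Longrightarrow> orthogonal (x - E *v x) v"
    and uniq: "\<And>x y. y \<in> V \<Longrightarrow> (\<And>v. v \<in> V \<Longrightarrow> orthogonal (x - y) v) \<Longrightarrow> E *v x = y"
    using orthogonal_projection_matrix[OF sub] by blast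
  have id: "E *v v = v" if "v \<in> V" for v
    using that by (intro uniq) (auto simp: orthogonal_def)
  have "E ** E = E"
    by (simp add: matrix_eq matrix_vector_mul_assoc[symmetric] id E)
  moreover have "E \<in> commutant"
    unfolding commutant_def
  proof (intro CollectI ballI)
    fix M assume M: "M \<in> A"
    define M' where "M' = (\<chi> i j. cnj (M $ j $ i))"
    have M': "M' \<in> A" by (rule algebraI) (simp add: M'_def algebra_invariant[OF M])
    have adj: "inner (M *v x) y = inner x (M' *v y)" for x y
    proof -
      have "inner (M *v x) y = Re (\<Sum>i\<in>UNIV. \<Sum>j\<in>UNIV. M $ i $ j * x $ j * cnj (y $ i))"
        unfolding inner_vec_complex matrix_vector_mult_def by (simp only: vec_lambda_beta sum_distrib_right)
      also have "\<dots> = Re (\<Sum>j\<in>UNIV. \<Sum>i\<in>UNIV. M $ i $ j * x $ j * cnj (y $ i))"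
        by (subst sum.swap) simp
      also have "\<dots> = Re (\<Sum>j\<in>UNIV. x $ j * cnj (\<Sum>i\<in>UNIV. M' $ j $ i * y $ i))"
        unfolding cnj_sum sum_distrib_left complex_cnj_mult by (simp add: M'_def mult_ac del: Re_sum)
      also have "\<dots> = inner x (M' *v y)"
        unfolding inner_vec_complex matrix_vector_mult_def by (simp only: vec_lambda_beta)
      finally show ?thesis .
    qed
    have "E *v (M *v x) = M *v (E *v x)" for x
    proof (rule uniq)
      show "M *v (E *v x) \<in> V" using V M E unfolding submodule_def by blast
      fix v assume "v \<in> V"
      then have "M' *v v \<in> V" using V M' unfolding submodule_def by blast
      then show "orthogonal (M *v x - M *v (E *v x)) v"
        using E(2)[of "M' *v v" x] adj
        by (simp add: orthogonal_def matrix_vector_mult_diff_distrib[symmetric])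
    qed
    then show "E ** M = M ** E"
      by (simp add: matrix_eq matrix_vector_mul_assoc[symmetric])
  qed
  ultimately show ?thesis using that E id by blast
qed

text \<open>Complete reducibility in the form used below: equations in the commutant may be tested
  on irreducible submodules. Project onto the kernel of X by a commuting E; if the kernel of E were
  nonzero, it would contain an irreducible submodule, which X kills and E therefore both fixes and
  annihilates.\<close>

lemma commutant_zeroI:
  assumes X: "X \<in> commutant" and kill: "\<And>W w. irreducible_submodule S W \<Longrightarrow> w \<in> W \<Longrightarrow> X *v w = 0"
  shows "X = 0"
proof -
  have "submodule S {v \<in> UNIV. X *v v = 0}" by (rule submodule_kernel[OF submodule_UNIV X])
  then obtain E where E: "E \<in> commutant" "E ** E = E" "\<And>x. X *v (E *v x) = 0"
      "\<And>v. X *v v = 0 \<Longrightarrow> E *v v = v"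
    by (rule commuting_projection) auto
  let ?U = "{v \<in> UNIV. E *v v = 0}"
  have "?U = {0}"
  proof (rule ccontr)
    assume "?U \<noteq> {0}"
    then obtain W where W: "irreducible_submodule S W" "W \<subseteq> ?U"
      using contains_irreducible[OF submodule_kernel[OF submodule_UNIV E(1)]] by blast
    then have "w = 0" if "w \<in> W" for w
      using that kill[of W w] E(4)[of w] by auto
    then show False using irreducible_nonzero[OF W(1)] by blast
  qed
  moreover have "x - E *v x \<in> ?U" for x
    by (simp add: matrix_vector_mult_diff_distrib matrix_vector_mul_assoc E(2))
  ultimately have "E *v x = x" for x
    by (metis (no_types, lifting) eq_iff_diff_eq_0 singletonD)
  then show ?thesis
    using E(3) by (simp add: matrix_eq)
qed

end

section \<open>Group sums of conjugates and the Casimir operator\<close>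

lemma trace_mat_mult: "trace (mat c ** M) = c * trace M" for M :: "'b::field^'n^'n"
  by (simp add: trace_def mat_mult_component sum_distrib_left)

lemma mat_mult_cancel: "c \<noteq> 0 \<Longrightarrow> mat c ** M = mat c ** N \<Longrightarrow> M = N" for M :: "'b::field^'n^'m"
  by (simp add: vec_eq_iff mat_mult_component)

lemma bij_betw_compose_right:
  assumes G: "perm_group G" and h: "h \<in> G"
  shows "bij_betw (\<lambda>g. g \<circ> h) G G"
  by (rule bij_betw_byWitness[where f'="\<lambda>g. g \<circ> inv h"])
     (use h in \<open>auto simp: perm_groupD[OF G] fun_eq_iff\<close>)

lemma bij_betw_compose_left:
  assumes G: "perm_group G" and h: "h \<in> G"
  shows "bij_betw (\<lambda>g. h \<circ> g) G G"
  by (rule bij_betw_byWitness[where f'="\<lambda>g. inv h \<circ> g"])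
     (use h in \<open>auto simp: perm_groupD[OF G] fun_eq_iff\<close>)

context group_scheme
begin

lemma card_group_nonzero: "card G \<noteq> 0"
  using perm_groupD(2)[OF G] by (auto simp: card_eq_0_iff)

text \<open>The sum is not divided by \<open>card G\<close>, which therefore appears in the trace.
  For X in the commutant the result lies in the center of A.\<close>

definition group_average :: "complex^'a^'a \<Rightarrow> complex^'a^'a" where
  "group_average X = (\<Sum>g\<in>G. perm_matrix g ** X ** perm_matrix (inv g))"

lemma conjugate_component:
  "g \<in> G \<Longrightarrow> (perm_matrix g ** X ** perm_matrix (inv g)) $ a $ b = X $ g a $ g b"
  using perm_groupD(1)[OF G, of g]
  by (simp add: perm_matrix_mul_right perm_matrix_mul_left bij_imp_bij_inv inv_inv_eq)

lemma group_average_component: "group_average X $ a $ b = (\<Sum>g\<in>G. X $ g a $ g b)"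
  by (simp add: group_average_def conjugate_component)

lemma group_average_algebra: "group_average X \<in> A"
proof (rule algebraI)
  fix h a b assume h: "h \<in> G"
  have "(\<Sum>g\<in>G. X $ (g \<circ> h) a $ (g \<circ> h) b) = (\<Sum>g\<in>G. X $ g a $ g b)"
    by (rule sum.reindex_bij_betw[OF bij_betw_compose_right[OF G h]])
  then show "group_average X $ h a $ h b = group_average X $ a $ b"
    by (simp add: group_average_component)
qed

lemma group_average_commutant: "X \<in> commutant \<Longrightarrow> group_average X \<in> commutant"
  unfolding group_average_def
  by (intro commutant_sum commutant_mult commutant_perm_matrix) (auto simp: perm_groupD[OF G])

lemma trace_group_average: "trace (group_average X) = of_nat (card G) * trace X"
proof -
  have "trace (group_average X) = (\<Sum>g\<in>G. \<Sum>a\<in>UNIV. X $ g a $ g a)"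
    unfolding trace_def group_average_component by (rule sum.swap)
  also have "\<dots> = (\<Sum>g\<in>G. trace X)"
    unfolding trace_def
    by (intro sum.cong refl sum.reindex_bij_betw[where g="\<lambda>a. X $ a $ a"] perm_groupD(1)[OF G])
  finally show ?thesis by simp
qed

text \<open>Up to scaling, this is \<open>\<Sum>\<^sub>s A\<^sub>s X A\<^sub>s\<^sup>T / n\<^sub>s\<close>, so it commutes with left and right multiplication by
  the commutant (\<open>casimir_orbit_matrix\<close>).\<close>
definition casimir :: "complex^'a^'a \<Rightarrow> complex^'a^'a" where
  "casimir X = (\<Sum>g\<in>G. mat (\<Sum>c\<in>UNIV. X $ c $ g c) ** perm_matrix g)"

lemma casimir_component: "casimir X $ a $ b = (\<Sum>g\<in>G. if g a = b then (\<Sum>c\<in>UNIV. X $ c $ g c) else 0)"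
  unfolding casimir_def sum_component mat_mult_component
  by (intro sum.cong) (auto simp: perm_matrix_def)

text \<open>This is the matrix unit at (x, y) summed over G: the adjacency matrix of the orbital of
  (x, y), multiplied by the order of the two-point stabilizer.\<close>

definition orbit_matrix :: "'a \<Rightarrow> 'a \<Rightarrow> complex^'a^'a" where
  "orbit_matrix x y = (\<chi> a b. \<Sum>g\<in>G. if g x = a \<and> g y = b then 1 else 0)"

lemma orbit_matrix_algebra: "orbit_matrix x y \<in> A" "transpose (orbit_matrix x y) \<in> A"
proof -
  have inv: "orbit_matrix x y $ h a $ h b = orbit_matrix x y $ a $ b" if h: "h \<in> G" for h a b
  proof -
    have eq: "(h \<circ> g) z = h c \<longleftrightarrow> g z = c" for g z c
      using perm_groupD(1)[OF G h] by (auto simp: bij_is_inj inj_eq)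
    have "(\<Sum>g\<in>G. if (h \<circ> g) x = h a \<and> (h \<circ> g) y = h b then 1 else 0)
      = (\<Sum>g\<in>G. if g x = h a \<and> g y = h b then (1::complex) else 0)"
      by (rule sum.reindex_bij_betw[OF bij_betw_compose_left[OF G h]])
    then show ?thesis
      unfolding eq by (simp add: orbit_matrix_def)
  qed
  show "orbit_matrix x y \<in> A" "transpose (orbit_matrix x y) \<in> A"
    by (intro algebraI; simp add: inv transpose_def)+
qed

lemma orbit_matrix_sandwich:
  "(orbit_matrix x y ** X ** transpose (orbit_matrix x y)) $ a $ b
    = (\<Sum>g\<in>G. \<Sum>h\<in>G. if g x = a \<and> h x = b then X $ g y $ h y else 0)"
proof -
  have left: "(orbit_matrix x y ** X) $ a $ d = (\<Sum>g\<in>G. if g x = a then X $ g y $ d else 0)" for d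
  proof -
    have "(orbit_matrix x y ** X) $ a $ d
      = (\<Sum>c\<in>UNIV. \<Sum>g\<in>G. if g y = c then (if g x = a then X $ c $ d else 0) else 0)"
      unfolding matrix_matrix_mult_def orbit_matrix_def vec_lambda_beta sum_distrib_right
      by (intro sum.cong) auto
    also have "\<dots> = (\<Sum>g\<in>G. \<Sum>c\<in>UNIV. if g y = c then (if g x = a then X $ c $ d else 0) else 0)"
      by (rule sum.swap)
    finally show ?thesis by simp
  qed
  have "(Y ** transpose (orbit_matrix x y)) $ a $ b
    = (\<Sum>d\<in>UNIV. \<Sum>h\<in>G. if h y = d then (if h x = b then Y $ a $ d else 0) else 0)" for Y :: "complex^'a^'a"
    unfolding matrix_matrix_mult_def transpose_def orbit_matrix_def vec_lambda_beta sum_distrib_left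
    by (intro sum.cong) auto
  then have "(orbit_matrix x y ** X ** transpose (orbit_matrix x y)) $ a $ b
    = (\<Sum>d\<in>UNIV. \<Sum>h\<in>G. if h y = d then (if h x = b then (orbit_matrix x y ** X) $ a $ d else 0) else 0)" .
  also have "\<dots> = (\<Sum>h\<in>G. \<Sum>d\<in>UNIV. if h y = d then (if h x = b then (orbit_matrix x y ** X) $ a $ d else 0) else 0)"
    by (rule sum.swap)
  also have "\<dots> = (\<Sum>h\<in>G. \<Sum>g\<in>G. if g x = a \<and> h x = b then X $ g y $ h y else 0)"
    by (intro sum.cong) (auto simp: left intro!: sum.cong)
  also have "\<dots> = (\<Sum>g\<in>G. \<Sum>h\<in>G. if g x = a \<and> h x = b then X $ g y $ h y else 0)"
    by (rule sum.swap)
  finally show ?thesis .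
qed

text \<open>This rewrites \<open>casimir\<close>, defined by permutation matrices, through elements
  of A, past which the commutant can be moved.\<close>

lemma casimir_orbit_matrix:
  "mat (of_nat (card G)) ** casimir X
    = (\<Sum>x\<in>UNIV. \<Sum>y\<in>UNIV. orbit_matrix x y ** X ** transpose (orbit_matrix x y))"
proof -
  have "(\<Sum>x\<in>UNIV. \<Sum>y\<in>UNIV. orbit_matrix x y ** X ** transpose (orbit_matrix x y)) $ a $ b
    = of_nat (card G) * casimir X $ a $ b" for a b
  proof -
    let ?t = "\<lambda>g h x y. if g x = a \<and> h x = b then X $ g y $ h y else 0"
    have inner: "(\<Sum>h\<in>G. \<Sum>x\<in>UNIV. \<Sum>y\<in>UNIV. ?t g h x y) = casimir X $ a $ b" if g: "g \<in> G" for g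
    proof -
      have bij: "bij g" by (rule perm_groupD(1)[OF G g])
      \<comment> \<open>Replacing h by \<open>h \<circ> g\<close> makes the summand depend on x and
        y only through g x and g y. Summing over all points then removes g, and the outer sum over g
        contributes the factor \<open>card G\<close>.\<close>
      have "(\<Sum>h\<in>G. \<Sum>x\<in>UNIV. \<Sum>y\<in>UNIV. ?t g h x y)
        = (\<Sum>h\<in>G. \<Sum>x\<in>UNIV. \<Sum>y\<in>UNIV. ?t g (h \<circ> g) x y)"
        by (rule sum.reindex_bij_betw[OF bij_betw_compose_right[OF G g], symmetric])
      also have "\<dots> = (\<Sum>h\<in>G. if h a = b then (\<Sum>c\<in>UNIV. X $ c $ h c) else 0)"
      proof (rule sum.cong[OF refl])
        fix h
        have "(\<Sum>x\<in>UNIV. \<Sum>y\<in>UNIV. ?t g (h \<circ> g) x y)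
          = (\<Sum>x\<in>UNIV. (\<lambda>z. if z = a \<and> h z = b then (\<Sum>y\<in>UNIV. (\<lambda>c. X $ c $ h c) (g y)) else 0) (g x))"
          by (intro sum.cong refl) (auto intro!: sum.neutral)
        also have "\<dots> = (\<Sum>z\<in>UNIV. if z = a \<and> h z = b then (\<Sum>y\<in>UNIV. (\<lambda>c. X $ c $ h c) (g y)) else 0)"
          by (rule sum.reindex_bij_betw[OF bij])
        also have "(\<Sum>y\<in>UNIV. (\<lambda>c. X $ c $ h c) (g y)) = (\<Sum>c\<in>UNIV. X $ c $ h c)"
          by (rule sum.reindex_bij_betw[OF bij])
        also have "(\<Sum>z\<in>UNIV. if z = a \<and> h z = b then (\<Sum>c\<in>UNIV. X $ c $ h c) else 0)
          = (\<Sum>z\<in>UNIV. if z = a then (if h a = b then (\<Sum>c\<in>UNIV. X $ c $ h c) else 0) else 0)"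
          by (intro sum.cong) auto
        also have "\<dots> = (if h a = b then (\<Sum>c\<in>UNIV. X $ c $ h c) else 0)"
          by simp
        finally show "(\<Sum>x\<in>UNIV. \<Sum>y\<in>UNIV. ?t g (h \<circ> g) x y)
          = (if h a = b then (\<Sum>c\<in>UNIV. X $ c $ h c) else 0)" .
      qed
      finally show ?thesis by (simp only: casimir_component)
    qed
    have "(\<Sum>x\<in>UNIV. \<Sum>y\<in>UNIV. orbit_matrix x y ** X ** transpose (orbit_matrix x y)) $ a $ b
      = (\<Sum>x\<in>UNIV. \<Sum>y\<in>UNIV. \<Sum>g\<in>G. \<Sum>h\<in>G. ?t g h x y)"
      by (simp only: sum_component orbit_matrix_sandwich)
    also have "\<dots> = (\<Sum>x\<in>UNIV. \<Sum>g\<in>G. \<Sum>y\<in>UNIV. \<Sum>h\<in>G. ?t g h x y)"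
      by (intro sum.cong refl sum.swap)
    also have "\<dots> = (\<Sum>g\<in>G. \<Sum>x\<in>UNIV. \<Sum>y\<in>UNIV. \<Sum>h\<in>G. ?t g h x y)"
      by (rule sum.swap)
    also have "\<dots> = (\<Sum>g\<in>G. \<Sum>x\<in>UNIV. \<Sum>h\<in>G. \<Sum>y\<in>UNIV. ?t g h x y)"
      by (intro sum.cong refl sum.swap)
    also have "\<dots> = (\<Sum>g\<in>G. \<Sum>h\<in>G. \<Sum>x\<in>UNIV. \<Sum>y\<in>UNIV. ?t g h x y)"
      by (intro sum.cong refl sum.swap)
    also have "\<dots> = (\<Sum>g\<in>G. casimir X $ a $ b)"
      by (intro sum.cong refl inner)
    finally show ?thesis by simp
  qed
  then show ?thesis
    by (simp add: vec_eq_iff mat_mult_component)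
qed

text \<open>E commutes with every orbit matrix U and its transpose, so in each term U U^T it can be
  moved to the middle from either side.\<close>

lemma casimir_one_mult:
  assumes E: "E \<in> commutant"
  shows "E ** casimir (mat 1) = casimir E" "casimir (mat 1) ** E = casimir E"
proof -
  let ?N = "of_nat (card G) :: complex"
  let ?U = orbit_matrix
  have N: "?N \<noteq> 0" using card_group_nonzero by simp
  have UE: "?U x y ** E = E ** ?U x y" "transpose (?U x y) ** E = E ** transpose (?U x y)" for x y
    using commutantD[OF E] orbit_matrix_algebra by auto
  have "mat ?N ** (E ** casimir (mat 1)) = E ** (mat ?N ** casimir (mat 1))"
    by (simp add: matrix_mul_assoc mat_mult_commute)
  also have "\<dots> = mat ?N ** casimir E"
    by (simp add: casimir_orbit_matrix matrix_mul_sum_right matrix_mul_assoc UE)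
  finally show "E ** casimir (mat 1) = casimir E"
    by (rule mat_mult_cancel[OF N])
  have "mat ?N ** (casimir (mat 1) ** E) = (mat ?N ** casimir (mat 1)) ** E"
    by (simp add: matrix_mul_assoc)
  also have "\<dots> = mat ?N ** casimir E"
    by (simp add: casimir_orbit_matrix matrix_mul_sum_left matrix_mul_assoc[symmetric] UE(2))
  finally show "casimir (mat 1) ** E = casimir E"
    by (rule mat_mult_cancel[OF N])
qed

lemma casimir_commutant: "casimir X \<in> commutant"
  unfolding casimir_def by (intro commutant_sum commutant_mult commutant_mat commutant_perm_matrix)

text \<open>If \<open>group_average E\<close> is nonzero on W, then so is one of its conjugate
  summands, and E \<open>perm_matrix (inv g)\<close> gives a nonzero module map from W to V. By
  Schur it is an isomorphism, so W has the dimension of V and inherits scalar actions of A.\<close>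

lemma irreducible_transport:
  assumes V: "irreducible_submodule S V" and E: "E \<in> commutant" "\<And>x. E *v x \<in> V"
    and W: "irreducible_submodule S W" and nz: "w0 \<in> W" "group_average E *v w0 \<noteq> 0"
  shows "vec.dim W = vec.dim V"
    "Z \<in> A \<Longrightarrow> (\<And>v. v \<in> V \<Longrightarrow> Z *v v = z *s v) \<Longrightarrow> w \<in> W \<Longrightarrow> Z *v w = z *s w"
proof -
  obtain g where g: "g \<in> G" "E *v (perm_matrix (inv g) *v w0) \<noteq> 0"
  proof (rule ccontr)
    assume "\<not> thesis"
    then have "\<And>g. g \<in> G \<Longrightarrow> E *v (perm_matrix (inv g) *v w0) = 0" using that by blast
    then have "group_average E *v w0 = 0"
      by (simp add: group_average_def matrix_vector_sum_left matrix_vector_mul_assoc[symmetric])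
    with nz show False by blast
  qed
  define X where "X = E ** perm_matrix (inv g)"
  have X: "X \<in> commutant"
    unfolding X_def using g by (intro commutant_mult E commutant_perm_matrix) (auto simp: perm_groupD[OF G])
  have into: "X *v x \<in> V" for x
    by (simp add: X_def matrix_vector_mul_assoc[symmetric] E)
  have X0: "X *v w0 \<noteq> 0"
    using g by (simp add: X_def matrix_vector_mul_assoc)
  show "vec.dim W = vec.dim V"
    by (rule schur_iso(1)[OF V W X into nz(1) X0])
  assume Z: "Z \<in> A" "\<And>v. v \<in> V \<Longrightarrow> Z *v v = z *s v" and w: "w \<in> W"
  have "X *v (Z *v w - z *s w) = 0"
    using commutant_vector[OF X Z(1), of w] Z(2)[OF into, of w]
    by (simp add: matrix_vector_mult_diff_distrib vector_scalar_commute)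
  moreover have "Z *v w - z *s w \<in> W"
    using W Z(1) w unfolding irreducible_submodule_def submodule_def
    by (simp add: vec.subspace_diff vec.subspace_scale)
  ultimately have "Z *v w - z *s w = 0"
    by (rule schur_iso(2)[OF V W X into nz(1) X0, rotated])
  then show "Z *v w = z *s w" by simp
qed

text \<open>The eigenvalue of the Casimir operator on V and the rank of the central primitive
  idempotent F of V are both expressed through one number \<open>\<nu>\<close>; the constant ratio c
  then ties them together.\<close>

lemma casimir_on_irreducible:
  assumes V: "irreducible_submodule S V" and zero_sum: "\<And>v. v \<in> V \<Longrightarrow> (\<Sum>i\<in>UNIV. v $ i) = 0"
    and c: "\<forall>P \<in> central_primitive_idempotents S - {J_normalized}. m_P S P / real (n_P S P) = c"
  shows "c \<noteq> 0" "v \<in> V \<Longrightarrow> complex_of_real c *s (casimir (mat 1) *v v) = of_nat (card G) *s v"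
proof -
  let ?N = "of_nat (card G) :: complex"
  define d where "d = vec.dim V"
  have subV: "submodule S V" "vec.subspace V" "V \<noteq> {0}"
    using V unfolding irreducible_submodule_def submodule_def by auto
  obtain v0 where v0: "v0 \<in> V" "v0 \<noteq> 0"
    using irreducible_nonzero[OF V] by blast
  have d: "d \<noteq> 0"
    using v0 by (auto simp: d_def)
  obtain E where E: "E \<in> commutant" "E ** E = E" "\<And>x. E *v x \<in> V" "\<And>v. v \<in> V \<Longrightarrow> E *v v = v"
    using commuting_projection[OF subV(1)] by blast
  have "range ((*v) E) = V"
    using E(3,4) by (auto intro: range_eqI[OF sym])
  then have trE: "trace E = of_nat d"
    using trace_idempotent[OF E(2)] by (simp add: d_def)
  \<comment> \<open>Compressing a permutation matrix to V gives a commutant element that maps V into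
    V, hence a scalar \<open>\<mu> g\<close>.\<close>
  have "\<forall>g\<in>G. \<exists>m. \<forall>v\<in>V. (E ** perm_matrix g) *v v = m *s v"
    by (intro ballI schur_scalar[OF V] commutant_mult E commutant_perm_matrix)
       (auto simp: matrix_vector_mul_assoc[symmetric] E)
  then obtain \<mu> where "\<forall>g\<in>G. \<forall>v\<in>V. (E ** perm_matrix g) *v v = \<mu> g *s v"
    by metis
  then have \<mu>: "E *v (perm_matrix g *v v) = \<mu> g *s v" if "g \<in> G" "v \<in> V" for g v
    using that by (simp add: matrix_vector_mul_assoc)
  have inv: "inv g \<in> G" if "g \<in> G" for g
    using that by (simp add: perm_groupD[OF G])
  have tr_perm: "trace (E ** perm_matrix g) = \<mu> g * of_nat d" if g: "g \<in> G" for g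
  proof -
    have "E ** perm_matrix g ** E = mat (\<mu> g) ** E"
      by (simp add: matrix_eq matrix_vector_mul_assoc[symmetric] \<mu>[OF g E(3)])
         (simp add: matrix_vector_mul_assoc mat_mult_vector)
    moreover have "trace (E ** perm_matrix g ** E) = trace (E ** perm_matrix g)"
      by (subst trace_mul_sym) (simp add: matrix_mul_assoc E)
    ultimately show ?thesis by (simp add: trace_mat_mult trE)
  qed
  \<comment> \<open>The left side is the coefficient of \<open>perm_matrix g\<close> in
    \<open>casimir E\<close>, and equals the trace of E \<open>perm_matrix (inv g)\<close>.\<close>
  have coeff: "(\<Sum>i\<in>UNIV. E $ i $ g i) = \<mu> (inv g) * of_nat d" if g: "g \<in> G" for g
    using tr_perm[OF inv[OF g]] perm_groupD(1)[OF G g]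
    by (simp add: trace_def perm_matrix_mul_right bij_imp_bij_inv inv_inv_eq)
  define Q where "Q = group_average E"
  define \<nu> where "\<nu> = (\<Sum>g\<in>G. \<mu> (inv g) * \<mu> g)"
  have Q: "Q \<in> A" "Q \<in> commutant"
    unfolding Q_def by (rule group_average_algebra, rule group_average_commutant[OF E(1)])
  have Q_V: "Q *v v = \<nu> *s v" if v: "v \<in> V" for v
  proof -
    have "Q *v v \<in> V" using subV(1) Q(1) v unfolding submodule_def by blast
    then have "Q *v v = E *v (Q *v v)" by (simp add: E(4))
    also have "\<dots> = (\<Sum>g\<in>G. E *v (perm_matrix g *v (E *v (perm_matrix (inv g) *v v))))"
      by (simp add: Q_def group_average_def matrix_vector_sum_left matrix_vector_sum_right
          matrix_vector_mul_assoc[symmetric])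
    also have "\<dots> = (\<Sum>g\<in>G. (\<mu> (inv g) * \<mu> g) *s v)"
      by (intro sum.cong refl) (simp add: \<mu> inv v vector_scalar_commute)
    also have "\<dots> = \<nu> *s v"
      by (simp add: \<nu>_def vec.scale_sum_left)
    finally show ?thesis .
  qed
  have K_V: "casimir (mat 1) *v v = (of_nat d * \<nu>) *s v" if v: "v \<in> V" for v
  proof -
    have "casimir (mat 1) *v v = casimir E *v v"
      using casimir_one_mult(2)[OF E(1)] E(4)[OF v] by (metis matrix_vector_mul_assoc)
    also have "\<dots> = E *v (casimir E *v v)"
      using casimir_one_mult(1)[OF E(1)] E(2) by (metis matrix_vector_mul_assoc matrix_mul_assoc)
    also have "\<dots> = (\<Sum>g\<in>G. (\<mu> (inv g) * of_nat d * \<mu> g) *s v)"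
      unfolding casimir_def matrix_vector_sum_left matrix_vector_sum_right mat_mult_vector
      by (intro sum.cong refl) (simp add: coeff vector_scalar_commute \<mu> v)
    also have "\<dots> = (of_nat d * \<nu>) *s v"
      by (simp add: \<nu>_def vec.scale_sum_left sum_distrib_left mult_ac)
    finally show ?thesis .
  qed
  have trQ: "trace Q = ?N * of_nat d"
    by (simp add: Q_def trace_group_average trE)
  note transport = irreducible_transport[OF V E(1,3), folded Q_def d_def]
  \<comment> \<open>On each irreducible submodule Q is either zero or \<open>\<nu>\<close>. If
    \<open>\<nu>\<close> vanished, Q would be zero, against its trace.\<close>
  have \<nu>: "\<nu> \<noteq> 0"
  proof
    assume "\<nu> = 0"
    have "Q = 0"
    proof (rule commutant_zeroI[OF Q(2)], rule ccontr)
      fix W w assume W: "irreducible_submodule S W" "w \<in> W" "Q *v w \<noteq> 0"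
      then have "Q *v w = \<nu> *s w"
        by (intro transport(2)[OF W Q(1) Q_V])
      with W \<open>\<nu> = 0\<close> show False by simp
    qed
    then have "trace Q = 0" by (simp add: trace_def)
    with trQ d card_group_nonzero show False by simp
  qed
  \<comment> \<open>F is the identity on irreducible submodules isomorphic to V and zero on all
    others (\<open>F_dichotomy\<close>), so the equations below can be checked by
    \<open>commutant_zeroI\<close>.\<close>
  define F where "F = mat (1 / \<nu>) ** Q"
  have F: "F \<in> A" "F \<in> commutant"
    unfolding F_def by (intro algebra_mult algebra_mat Q, intro commutant_mult commutant_mat Q)
  have F_vec: "F *v x = (1 / \<nu>) *s (Q *v x)" for x
    by (simp add: F_def mat_mult_vector)
  have F_V: "F *v v = 1 *s v" if "v \<in> V" for v
    using that \<nu> by (simp add: F_vec Q_V)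
  have F_dichotomy: "(\<forall>w\<in>W. F *v w = 0) \<or> vec.dim W = d \<and>
      (\<forall>Z\<in>A. \<forall>z. (\<forall>v\<in>V. Z *v v = z *s v) \<longrightarrow> (\<forall>w\<in>W. Z *v w = z *s w))"
    if W: "irreducible_submodule S W" for W
  proof (cases "\<forall>w\<in>W. Q *v w = 0")
    case False
    then obtain w0 where w0: "w0 \<in> W" "Q *v w0 \<noteq> 0" by blast
    show ?thesis using transport[OF W w0] by blast
  qed (simp add: F_vec)
  have "F ** F - F = 0"
  proof (rule commutant_zeroI)
    fix W w assume W: "irreducible_submodule S W" "w \<in> W"
    show "(F ** F - F) *v w = 0"
      using F_dichotomy[OF W(1)]
    proof
      assume "vec.dim W = d \<and> (\<forall>Z\<in>A. \<forall>z. (\<forall>v\<in>V. Z *v v = z *s v) \<longrightarrow> (\<forall>w\<in>W. Z *v w = z *s w))"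
      then have "F *v w = 1 *s w" using F(1) F_V W(2) by blast
      then show ?thesis by (simp add: matrix_vector_mult_diff_rdistrib matrix_vector_mul_assoc[symmetric])
    qed (use W in \<open>simp add: matrix_vector_mult_diff_rdistrib matrix_vector_mul_assoc[symmetric]\<close>)
  qed (intro commutant_diff commutant_mult F)
  then have idem: "F ** F = F" by simp
  have central: "central_idempotent S F"
    unfolding central_idempotent_def using F idem commutantD by blast
  have F0: "F \<noteq> 0" using F_V[OF v0(1)] v0(2) by auto
  \<comment> \<open>P acts on V by a scalar z with z * z = z. The same scalar occurs wherever F is
    the identity, and P vanishes where F does; so z = 0 gives P = 0, and z = 1 gives P = F.\<close>
  have prim: "P = 0 \<or> P = F" if P: "central_idempotent S P" "F ** P = P" for P
  proof -
    have PA: "P \<in> A" "P ** P = P" and PC: "P \<in> commutant"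
      using P(1) unfolding central_idempotent_def commutant_def by auto
    have PF: "P *v x = P *v (F *v x)" for x
      using P(2) commutantD[OF F(2) PA(1)] by (simp add: matrix_vector_mul_assoc)
    obtain z where z: "\<forall>v\<in>V. P *v v = z *s v"
      using schur_scalar[OF V PC] subV(1) PA(1) unfolding submodule_def by blast
    have "P *v (P *v v0) = P *v v0" using PA(2) by (simp add: matrix_vector_mul_assoc)
    then have "(z * z) *s v0 = z *s v0"
      using z v0 by (simp add: vector_scalar_commute)
    then have "z * z = z" using v0(2) vec.scale_right_imp_eq by blast
    then consider "z = 0" | "z = 1" by auto
    then show ?thesis
    proof cases
      case 1
      have "P = 0"
      proof (rule commutant_zeroI[OF PC])
        fix W w assume W: "irreducible_submodule S W" "w \<in> W"
        show "P *v w = 0"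
          using F_dichotomy[OF W(1)]
        proof
          assume "\<forall>w\<in>W. F *v w = 0"
          then show ?thesis using PF[of w] W by simp
        next
          assume "vec.dim W = d \<and> (\<forall>Z\<in>A. \<forall>z. (\<forall>v\<in>V. Z *v v = z *s v) \<longrightarrow> (\<forall>w\<in>W. Z *v w = z *s w))"
          then have "P *v w = z *s w" using PA(1) z W(2) by blast
          with 1 show ?thesis by simp
        qed
      qed
      then show ?thesis ..
    next
      case 2
      have "P - F = 0"
      proof (rule commutant_zeroI)
        fix W w assume W: "irreducible_submodule S W" "w \<in> W"
        show "(P - F) *v w = 0"
          using F_dichotomy[OF W(1)]
        proof
          assume "\<forall>w\<in>W. F *v w = 0"
          then show ?thesis using PF[of w] W by (simp add: matrix_vector_mult_diff_rdistrib)
        next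
          assume tr: "vec.dim W = d \<and> (\<forall>Z\<in>A. \<forall>z. (\<forall>v\<in>V. Z *v v = z *s v) \<longrightarrow> (\<forall>w\<in>W. Z *v w = z *s w))"
          then have "P *v w = z *s w" using PA(1) z W(2) by blast
          moreover have "F *v w = 1 *s w" using tr F(1) F_V W(2) by blast
          ultimately show ?thesis using 2 by (simp add: matrix_vector_mult_diff_rdistrib)
        qed
      qed (intro commutant_diff PC F)
      then show ?thesis by simp
    qed
  qed
  have FP: "F \<in> central_primitive_idempotents S"
    unfolding central_primitive_idempotents_def using central F0 prim by blast
  \<comment> \<open>F fixes v0 while the normalized all-one matrix kills it, so F is subject to the
    pseudocyclic condition.\<close>
  have "J_normalized *v v0 = 0"
    using zero_sum[OF v0(1)]
    by (simp add: J_normalized_def matrix_vector_mult_def vec_eq_iff sum_divide_distrib[symmetric])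
  then have FJ: "F \<noteq> J_normalized" using F_V[OF v0(1)] v0(2) by auto
  \<comment> \<open>\<open>n_P\<close> uses an arbitrarily chosen submodule. V shows that a choice
    exists, and \<open>F_dichotomy\<close> gives every choice dimension d.\<close>
  define V' where "V' = (SOME V. irreducible_submodule S V \<and> (\<forall>v\<in>V. F *v v = v))"
  have V': "irreducible_submodule S V'" "\<forall>v\<in>V'. F *v v = v"
    using someI[of "\<lambda>V. irreducible_submodule S V \<and> (\<forall>v\<in>V. F *v v = v)" V] V F_V
    unfolding V'_def by simp_all
  then obtain v' where "v' \<in> V'" "v' \<noteq> 0"
    using irreducible_nonzero by blast
  then have "vec.dim V' = d" using F_dichotomy[OF V'(1)] V'(2) by auto
  then have nP: "n_P S F = d" unfolding n_P_def V'_def .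
  have "real (rank F) / real d / real d = c"
    using c FP FJ nP unfolding m_P_def by auto
  then have "real (rank F) = c * real d * real d" using d by (simp add: field_simps)
  \<comment> \<open>Rank equals trace for the idempotent F. Comparing this with rank F = c d^2 gives
    c (d \<open>\<nu>\<close>) = \<open>card G\<close>, where d \<open>\<nu>\<close> is the Casimir
    eigenvalue from \<open>K_V\<close>.\<close>
  moreover have "complex_of_real (real (rank F)) = 1 / \<nu> * (?N * of_nat d)"
    using trace_idempotent_rank[OF idem] by (simp add: F_def trace_mat_mult trQ)
  ultimately have "complex_of_real c * of_nat d * of_nat d * \<nu> = ?N * of_nat d"
    using \<nu> by (simp add: field_simps)
  then have key: "complex_of_real c * (of_nat d * \<nu>) = ?N"
    using d by simp
  show "c \<noteq> 0" using key card_group_nonzero by auto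
  show "complex_of_real c *s (casimir (mat 1) *v v) = ?N *s v" if "v \<in> V"
    using K_V[OF that] key by simp
qed

end

section \<open>Fixed points in transitive groups\<close>

lemma card_fiber:
  assumes G: "perm_group G" and g: "g \<in> G" "g x = y"
  shows "card {f \<in> G. f x = y} = card {f \<in> G. f x = x}"
proof (rule bij_betw_same_card[of "\<lambda>f. inv g \<circ> f"], rule bij_betw_byWitness[where f'="\<lambda>f. g \<circ> f"])
  show "(\<lambda>f. inv g \<circ> f) ` {f \<in> G. f x = y} \<subseteq> {f \<in> G. f x = x}"
    using g by (auto simp: perm_groupD[OF G])
  show "(\<lambda>f. g \<circ> f) ` {f \<in> G. f x = x} \<subseteq> {f \<in> G. f x = y}"
    using g by (auto simp: perm_groupD[OF G])
qed (use g in \<open>auto simp: perm_groupD[OF G] fun_eq_iff\<close>)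

lemma orbit_stabilizer:
  fixes G :: "('a::finite \<Rightarrow> 'a) set"
  assumes G: "perm_group G"
  shows "card G = card {y. \<exists>g\<in>G. g x = y} * card {g \<in> G. g x = x}"
proof -
  let ?O = "{y. \<exists>g\<in>G. g x = y}"
  have "card G = card (\<Union>y\<in>?O. {g \<in> G. g x = y})"
    by (rule arg_cong[of _ _ card]) auto
  also have "\<dots> = (\<Sum>y\<in>?O. card {g \<in> G. g x = y})"
    by (rule card_UN_disjoint) auto
  also have "\<dots> = (\<Sum>y\<in>?O. card {g \<in> G. g x = x})"
    by (intro sum.cong refl) (auto intro: card_fiber[OF G])
  finally show ?thesis by simp
qed

lemma perm_group_stabilizer:
  assumes "perm_group G"
  shows "perm_group {g \<in> G. g a = a}"
  unfolding perm_group_def using perm_groupD[OF assms]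
  by auto (metis perm_groupD(5)[OF assms])

lemma sum_card_fixed_points:
  fixes H :: "('a::finite \<Rightarrow> 'a) set"
  shows "(\<Sum>g\<in>H. card {c. g c = c}) = (\<Sum>c\<in>UNIV. card {g \<in> H. g c = c})"
proof -
  have "(\<Sum>g\<in>H. card {c \<in> UNIV. g c = c}) = (\<Sum>g\<in>H. \<Sum>c\<in>UNIV. if g c = c then 1 else 0)"
    by (simp only: card_eq_sum sum.inter_filter[OF finite])
  also have "\<dots> = (\<Sum>c\<in>UNIV. \<Sum>g\<in>H. if g c = c then 1 else 0)"
    by (rule sum.swap)
  also have "\<dots> = (\<Sum>c\<in>UNIV. card {g \<in> H. g c = c})"
    by (simp only: card_eq_sum sum.inter_filter[OF finite])
  finally show ?thesis by simp
qed

text \<open>The purely combinatorial half. In the proof m is the order of a point stabilizer and h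
  that of a two-point stabilizer, with m = k h; the aim is h = 1.\<close>

lemma frobenius_if_constant_fixed_point_sums:
  fixes G :: "('a::finite \<Rightarrow> 'a) set"
  assumes tr: "transitive_group G" and k: "k > 1"
    and orb: "\<And>a x. a \<noteq> x \<Longrightarrow> card {y. \<exists>g\<in>G. g a = a \<and> g x = y} = k"
    and n: "CARD('a) = 1 + t * k" and t: "t \<ge> 2 * (k - 1)"
    and const: "\<And>a b b'. a \<noteq> b \<Longrightarrow> a \<noteq> b' \<Longrightarrow>
      (\<Sum>g\<in>{g \<in> G. g a = b}. card {c. g c = c}) = (\<Sum>g\<in>{g \<in> G. g a = b'}. card {c. g c = c})"
  shows "frobenius_group G"
proof -
  have G: "perm_group G" using tr unfolding transitive_group_def by blast
  have trans: "\<exists>g\<in>G. g x = y" for x y using tr unfolding transitive_group_def by blast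
  note stab = perm_group_stabilizer[OF G]
  define m where "m = card G div CARD('a)"
  define h where "h = m div k"
  have m: "card {g \<in> G. g a = a} = m" for a
  proof -
    have "{y. \<exists>g\<in>G. g a = y} = UNIV" using trans by auto
    then show ?thesis using orbit_stabilizer[OF G, of a] by (simp add: m_def)
  qed
  have mk: "m = k * card {g \<in> G. g a = a \<and> g x = x}" if "a \<noteq> x" for a x
    using orbit_stabilizer[OF stab[of a], of x] orb[OF that] m[of a]
    by (simp add: conj_assoc Bex_def)
  then have h: "card {g \<in> G. g a = a \<and> g x = x} = h" if "a \<noteq> x" for a x
    using mk[OF that] k by (simp add: h_def)
  have q: "k - 1 \<ge> 1" using k by simp
  have "t > 0" using t q by linarith
  then have n2: "CARD('a) > 1" using n k by simp
  then obtain a0 x0 :: 'a where ax: "a0 \<noteq> x0"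
    using card_le_Suc0_iff_eq[of "UNIV :: 'a set"] by auto
  have mkh: "m = k * h" using mk[OF ax] h[OF ax] by simp
  have "id \<in> {g \<in> G. g a0 = a0}" using perm_groupD(2)[OF G] by simp
  then have "card {g \<in> G. g a0 = a0} > 0"
    unfolding card_gt_0_iff by (intro conjI finite) blast
  then have "m > 0" by (simp only: m)
  then have h0: "h > 0" using mkh by simp
  have diag: "(\<Sum>g\<in>{g \<in> G. g a = a}. card {c. g c = c}) = m + t * k * h" for a
  proof -
    have "(\<Sum>g\<in>{g \<in> G. g a = a}. card {c. g c = c}) = (\<Sum>c\<in>UNIV. card {g \<in> G. g a = a \<and> g c = c})"
      unfolding sum_card_fixed_points by (simp add: conj_assoc)
    also have "\<dots> = card {g \<in> G. g a = a \<and> g a = a} + (\<Sum>c\<in>UNIV - {a}. card {g \<in> G. g a = a \<and> g c = c})"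
      by (rule sum.remove) auto
    also have "(\<Sum>c\<in>UNIV - {a}. card {g \<in> G. g a = a \<and> g c = c}) = (\<Sum>c\<in>UNIV - {a}. h)"
      by (intro sum.cong refl h) auto
    also have "\<dots> = t * k * h" using n by (simp add: card_Diff_singleton)
    finally show ?thesis using m by simp
  qed
  \<comment> \<open>The sum of all fixed point numbers is n m. Removing the part with g a = a leaves
    t k equal sums, one for each b different from a. The result is stated with h added on the left
    to avoid subtraction.\<close>
  have off: "(\<Sum>g\<in>{g \<in> G. g a = b}. card {c. g c = c}) + h = k * h" if ab: "a \<noteq> b" for a b
  proof -
    let ?R = "\<lambda>b. \<Sum>g\<in>{g \<in> G. g a = b}. card {c. g c = c}"
    have "CARD('a) * m = (\<Sum>g\<in>G. card {c. g c = c})"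
      unfolding sum_card_fixed_points m by simp
    also have "\<dots> = (\<Sum>b\<in>UNIV. ?R b)"
      by (rule sum.group[symmetric]) auto
    also have "\<dots> = ?R a + (\<Sum>b\<in>UNIV - {a}. ?R b)"
      by (rule sum.remove) auto
    also have "(\<Sum>b\<in>UNIV - {a}. ?R b) = (\<Sum>b'\<in>UNIV - {a}. ?R b)"
      using ab by (intro sum.cong refl const) auto
    also have "\<dots> = t * k * ?R b"
      using n by (simp add: card_Diff_singleton)
    finally have "m + t * k * m = m + t * k * h + t * k * ?R b"
      unfolding n diag by (simp add: algebra_simps)
    then have "t * k * m = t * k * (?R b + h)"
      by (simp add: algebra_simps)
    then show ?thesis using mkh \<open>t > 0\<close> k by simp
  qed
  \<comment> \<open>Choose a point a moved by g. For each fixed point c of g, the f with f c = c and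
    f a = g a form a coset of the stabilizer of a and c, so there are h of them. All these pairs (f,
    c) are counted by the sum in \<open>off\<close>.\<close>
  have fixed: "card {c. g c = c} \<le> k - 1" if g: "g \<in> G" "g \<noteq> id" for g
  proof -
    obtain a where a: "g a \<noteq> a" using g(2) by (auto simp: fun_eq_iff)
    have "card {c. g c = c} * h = (\<Sum>c\<in>{c. g c = c}. card {f \<in> G. f a = g a \<and> f c = c})"
    proof -
      have "card {f \<in> G. f a = g a \<and> f c = c} = h" if "g c = c" for c
      proof -
        have "a \<noteq> c" using a that by auto
        then have "card {f \<in> {f \<in> G. f c = c}. f a = g a} = card {f \<in> {f \<in> G. f c = c}. f a = a}"
          using g that by (intro card_fiber[OF stab, of g]) auto
        then show ?thesis using h[of c a] \<open>a \<noteq> c\<close> by (simp add: conj_ac)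
      qed
      then show ?thesis by simp
    qed
    also have "\<dots> \<le> (\<Sum>c\<in>UNIV. card {f \<in> G. f a = g a \<and> f c = c})"
      by (rule sum_mono2) auto
    also have "\<dots> = (\<Sum>f\<in>{f \<in> G. f a = g a}. card {c. f c = c})"
      unfolding sum_card_fixed_points by (simp add: conj_assoc)
    finally have "(card {c. g c = c} + 1) * h \<le> k * h"
      using off[of a "g a"] a by simp
    then have "card {c. g c = c} + 1 \<le> k" using h0 by (metis mult_le_cancel2)
    then show ?thesis by simp
  qed
  \<comment> \<open>The left side counts fixed points over the stabilizer of a0
    (\<open>diag\<close>). The identity fixes every point, and each of the m - 1 other elements at
    most k - 1.\<close>
  have "m + t * k * h \<le> CARD('a) + (m - 1) * (k - 1)"
  proof -
    let ?H = "{g \<in> G. g a0 = a0}"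
    have "m + t * k * h = card {c::'a. id c = c} + (\<Sum>g\<in>?H - {id}. card {c. g c = c})"
      unfolding diag[of a0, symmetric]
      using perm_groupD(2)[OF G] by (intro sum.remove[of ?H id "\<lambda>g. card {c. g c = c}"]) auto
    also have "\<dots> \<le> CARD('a) + (\<Sum>g\<in>?H - {id}. k - 1)"
      by (intro add_mono sum_mono fixed) auto
    also have "\<dots> = CARD('a) + (m - 1) * (k - 1)"
      using m[of a0] perm_groupD(2)[OF G] by (simp add: card_Diff_singleton)
    finally show ?thesis .
  qed
  have h1: "h = 1"
  proof (rule ccontr)
    assume "h \<noteq> 1"
    \<comment> \<open>These substitutions remove natural subtraction. For h at least 2 one has 2 (h
      - 1) at least h, so t k (h - 1) is at least m (k - 1); the inequality would then force m + (k
      - 1) to be at most 1.\<close>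
    then obtain i where i: "h = i + 2" using h0 that[of "h - 2"] by simp
    obtain j where j: "k = j + 2" using k that[of "k - 2"] by simp
    obtain u where u: "t = 2 * (j + 1) + u" using t j that[of "t - 2 * (j + 1)"] by simp
    have "m + t * k * h \<le> 1 + t * k + (m - 1) * (k - 1)"
      using \<open>m + t * k * h \<le> _\<close> n by simp
    then have "m + t * k * h + (k - 1) \<le> 1 + t * k + m * (k - 1)"
      using \<open>m > 0\<close> by (cases m) auto
    then show False
      unfolding mkh i j u by (simp add: algebra_simps)
  qed
  have trivial: "g = id" if "g \<in> G" "x \<noteq> y" "g x = x" "g y = y" for g x y
  proof -
    have "card {g \<in> G. g x = x \<and> g y = y} = 1" using h[OF that(2)] h1 by simp
    then obtain f where f: "{g \<in> G. g x = x \<and> g y = y} = {f}" by (auto simp: card_1_singleton_iff)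
    have "id \<in> {g \<in> G. g x = x \<and> g y = y}" "g \<in> {g \<in> G. g x = x \<and> g y = y}"
      using that perm_groupD(2)[OF G] by auto
    then show ?thesis unfolding f by simp
  qed
  have "\<exists>g\<in>G. g a0 = a0 \<and> g \<noteq> id"
  proof (rule ccontr)
    assume "\<not> ?thesis"
    then have "{g \<in> G. g a0 = a0} \<subseteq> {id}" by auto
    then have "card {g \<in> G. g a0 = a0} \<le> card {id :: 'a \<Rightarrow> 'a}" by (intro card_mono) auto
    then have "m \<le> 1" by (simp only: m card.insert) simp
    with mkh h1 k show False by simp
  qed
  then show ?thesis
    unfolding frobenius_group_def using tr trivial by blast
qed

section \<open>Pseudocyclic schemes of permutation groups\<close>

lemma J_normalized_vector: "J_normalized *v v = 0 \<longleftrightarrow> (\<Sum>i\<in>UNIV. v $ i) = 0"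
  by (simp add: J_normalized_def matrix_vector_mult_def vec_eq_iff sum_divide_distrib[symmetric])

context group_scheme
begin

lemma casimir_one_component:
  "casimir (mat 1) $ a $ b = of_nat (\<Sum>g\<in>{g \<in> G. g a = b}. card {c. g c = c})"
proof -
  have diag: "(\<Sum>c\<in>UNIV. (mat 1 :: complex^'a^'a) $ c $ g c) = of_nat (card {c. g c = c})" for g
  proof -
    have "(\<Sum>c\<in>UNIV. (mat 1 :: complex^'a^'a) $ c $ g c) = (\<Sum>c\<in>UNIV. if g c = c then 1 else 0)"
      by (intro sum.cong) (auto simp: mat_def)
    also have "\<dots> = (\<Sum>c\<in>{c \<in> UNIV. g c = c}. 1)"
      by (rule sum.inter_filter[symmetric]) simp
    finally show ?thesis by simp
  qed
  show ?thesis
    unfolding casimir_component of_nat_sum diag by (simp only: sum.inter_filter[OF finite])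
qed

lemma casimir_one_symmetric: "casimir (mat 1) $ a $ b = casimir (mat 1) $ b $ a"
proof -
  have inv_fixed: "{c. inv g c = c} = {c. g c = c}" if "g \<in> G" for g
    using perm_groupD(5,6)[OF G that] by (metis (full_types))
  have "(\<Sum>g\<in>{g \<in> G. g a = b}. card {c. g c = c}) = (\<Sum>g\<in>{g \<in> G. g b = a}. card {c. g c = c})"
    by (rule sum.reindex_bij_witness[where i=inv and j=inv])
       (auto simp: perm_groupD[OF G] inv_inv_eq inv_fixed)
  then show ?thesis by (simp only: casimir_one_component)
qed

text \<open>By transitivity all column sums of a matrix in A agree, so M multiplies the coordinate
  sum of a vector by a constant.\<close>

lemma submodule_zero_sum:
  assumes tr: "transitive_group G"
  shows "submodule S {v. (\<Sum>i\<in>UNIV. v $ i) = 0}"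
  unfolding submodule_def
proof (intro conjI ballI)
  show "vec.subspace {v :: complex^'a. (\<Sum>i\<in>UNIV. v $ i) = 0}"
    unfolding vec.subspace_def by (simp add: sum.distrib sum_distrib_left[symmetric])
  fix M and v :: "complex^'a" assume M: "M \<in> A" and v: "v \<in> {v. (\<Sum>i\<in>UNIV. v $ i) = 0}"
  have col: "(\<Sum>i\<in>UNIV. M $ i $ j) = (\<Sum>i\<in>UNIV. M $ i $ j')" for j j'
  proof -
    obtain g where g: "g \<in> G" "g j = j'" using tr unfolding transitive_group_def by blast
    have "(\<Sum>i\<in>UNIV. M $ g i $ j') = (\<Sum>i\<in>UNIV. M $ i $ j')"
      by (rule sum.reindex_bij_betw[OF perm_groupD(1)[OF G g(1)]])
    then show ?thesis
      using algebra_invariant[OF M g(1), of _ j] g(2) by simp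
  qed
  obtain j0 :: 'a where True by blast
  have "(\<Sum>i\<in>UNIV. (M *v v) $ i) = (\<Sum>j\<in>UNIV. \<Sum>i\<in>UNIV. M $ i $ j * v $ j)"
    unfolding matrix_vector_mult_def vec_lambda_beta by (rule sum.swap)
  also have "\<dots> = (\<Sum>j\<in>UNIV. (\<Sum>i\<in>UNIV. M $ i $ j0) * v $ j)"
    unfolding sum_distrib_right[symmetric] by (intro sum.cong refl arg_cong2[where f="(*)"] col)
  also have "\<dots> = 0"
    using v by (simp add: sum_distrib_left[symmetric])
  finally show "M *v v \<in> {v. (\<Sum>i\<in>UNIV. v $ i) = 0}" by simp
qed

text \<open>This passes from irreducible submodules to the whole zero-sum space, by showing that the
  difference Y of the two sides vanishes there.\<close>

lemma casimir_scalar_on_zero_sum: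
  assumes tr: "transitive_group G"
    and c: "\<forall>P \<in> central_primitive_idempotents S - {J_normalized}. m_P S P / real (n_P S P) = c"
    and v: "(\<Sum>i\<in>UNIV. v $ i) = 0"
  shows "complex_of_real c *s (casimir (mat 1) *v v) = of_nat (card G) *s v"
proof -
  let ?U = "{v :: complex^'a. (\<Sum>i\<in>UNIV. v $ i) = 0}"
  define Y where "Y = mat (complex_of_real c) ** casimir (mat 1) - mat (of_nat (card G))"
  have Y_vec: "Y *v x = complex_of_real c *s (casimir (mat 1) *v x) - of_nat (card G) *s x" for x
    using mat_mult_vector[of "of_nat (card G)" "mat 1"]
    by (simp add: Y_def matrix_vector_mult_diff_rdistrib mat_mult_vector)
  have Y: "Y \<in> commutant"
    unfolding Y_def by (intro commutant_diff commutant_mult commutant_mat casimir_commutant)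
  have JA: "J_normalized \<in> A"
    by (rule algebraI) (simp add: J_normalized_def)
  have Y_cnj: "Y $ i $ j = cnj (Y $ j $ i)" for i j
  proof -
    have "casimir (mat 1) $ i $ j = cnj (casimir (mat 1) $ j $ i)"
      unfolding casimir_one_symmetric[of i j] unfolding casimir_one_component by simp
    moreover have "mat (of_nat (card G)) $ i $ j = cnj (mat (of_nat (card G)) $ j $ i)"
      by (simp add: mat_def)
    ultimately show ?thesis by (simp add: Y_def mat_mult_component)
  qed
  have self_adj: "inner (Y *v x) y = inner x (Y *v y)" for x y
  proof -
    have "inner (Y *v x) y = Re (\<Sum>i\<in>UNIV. \<Sum>j\<in>UNIV. Y $ i $ j * x $ j * cnj (y $ i))"
      unfolding inner_vec_complex matrix_vector_mult_def by (simp only: vec_lambda_beta sum_distrib_right)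
    also have "\<dots> = Re (\<Sum>j\<in>UNIV. \<Sum>i\<in>UNIV. cnj (Y $ j $ i) * x $ j * cnj (y $ i))"
      by (subst sum.swap) (simp only: Y_cnj[symmetric])
    also have "\<dots> = Re (\<Sum>j\<in>UNIV. x $ j * cnj (\<Sum>i\<in>UNIV. Y $ j $ i * y $ i))"
      unfolding cnj_sum sum_distrib_left complex_cnj_mult by (simp only: mult_ac)
    also have "\<dots> = inner x (Y *v y)"
      unfolding inner_vec_complex matrix_vector_mult_def by (simp only: vec_lambda_beta)
    finally show ?thesis .
  qed
  \<comment> \<open>\<open>Y\<close> is self-adjoint, so its kernel meets its range trivially.\<close>
  have "(*v) Y ` ?U = {0}"
  proof (rule ccontr)
    assume "(*v) Y ` ?U \<noteq> {0}"
    then obtain W where W: "irreducible_submodule S W" "W \<subseteq> (*v) Y ` ?U"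
      using contains_irreducible[OF submodule_image[OF submodule_zero_sum[OF tr] Y]] by blast
    have zero: "(\<Sum>i\<in>UNIV. w $ i) = 0" if "w \<in> W" for w
    proof -
      obtain u where u: "J_normalized *v u = 0" "w = Y *v u"
        using \<open>w \<in> W\<close> W(2) J_normalized_vector by blast
      have "J_normalized *v w = 0"
        unfolding u(2) commutant_vector[OF Y JA] u(1) by simp
      then show ?thesis by (simp only: J_normalized_vector)
    qed
    obtain w where w: "w \<in> W" "w \<noteq> 0" using irreducible_nonzero[OF W(1)] by blast
    obtain u where u: "w = Y *v u" using w(1) W(2) by blast
    have "Y *v w = 0"
      using casimir_on_irreducible(2)[OF W(1) zero c w(1)] by (simp add: Y_vec)
    then have "inner w w = 0" unfolding u by (simp only: self_adj) (simp add: u)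
    with w(2) show False by simp
  qed
  then have "Y *v v = 0" using v by blast
  then show ?thesis by (simp add: Y_vec)
qed

text \<open>Apply the Casimir operator to the difference of the basis vectors at b and b' and read
  off the entry at a. It is zero because a differs from both, so the entries at (a, b) and (a, b')
  agree.\<close>

lemma fixed_point_sum_constant:
  assumes tr: "transitive_group G"
    and c: "\<forall>P \<in> central_primitive_idempotents S - {J_normalized}. m_P S P / real (n_P S P) = c"
    and ab: "a \<noteq> b" "a \<noteq> b'"
  shows "(\<Sum>g\<in>{g \<in> G. g a = b}. card {c. g c = c}) = (\<Sum>g\<in>{g \<in> G. g a = b'}. card {c. g c = c})"
proof -
  have diff_sum: "(\<Sum>i\<in>UNIV. (axis x 1 - axis y 1 :: complex^'a) $ i) = 0" for x y
    by (simp add: sum_subtractf axis_def)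
  have "c \<noteq> 0"
  proof -
    let ?U = "{v :: complex^'a. (\<Sum>i\<in>UNIV. v $ i) = 0}"
    have "axis a 1 - axis b 1 \<in> ?U" using diff_sum by simp
    moreover have "axis a 1 - axis b (1::complex) \<noteq> 0" using ab by (simp add: axis_eq_axis)
    ultimately have "?U \<noteq> {0}" by blast
    then obtain W where "irreducible_submodule S W" "W \<subseteq> ?U"
      using contains_irreducible[OF submodule_zero_sum[OF tr]] by blast
    then show ?thesis using casimir_on_irreducible(1)[OF _ _ c, of W] by blast
  qed
  let ?K = "casimir (mat 1)"
  have col: "(?K *v axis x 1) $ a = ?K $ a $ x" for x
    by (simp add: matrix_vector_mult_def axis_def if_distrib cong: if_cong)
  have "complex_of_real c * (?K *v (axis b 1 - axis b' 1)) $ a = of_nat (card G) * (axis b 1 - axis b' 1) $ a"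
    using casimir_scalar_on_zero_sum[OF tr c diff_sum] by (metis vector_smult_component)
  then have "?K $ a $ b = ?K $ a $ b'"
    using ab \<open>c \<noteq> 0\<close> by (simp add: matrix_vector_mult_diff_distrib col) (simp add: axis_def)
  then show ?thesis
    unfolding casimir_one_component by (simp only: of_nat_eq_iff)
qed

end

section \<open>Passing to the full automorphism group, and counting points\<close>

lemma perm_group_Aut: "perm_group (Aut S)"
proof -
  have "f \<circ> g \<in> Aut S" if "f \<in> Aut S" "g \<in> Aut S" for f g
  proof -
    have "(\<lambda>(x, y). ((f \<circ> g) x, (f \<circ> g) y)) ` s = (\<lambda>(x, y). (f x, f y)) ` (\<lambda>(x, y). (g x, g y)) ` s" for s
      by (auto simp: image_iff)
    with that show ?thesis unfolding Aut_def by (auto simp: bij_comp)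
  qed
  moreover have "inv f \<in> Aut S" if f: "f \<in> Aut S" for f
  proof -
    have bij: "bij f" and im: "\<And>s. s \<in> S \<Longrightarrow> (\<lambda>(x, y). (f x, f y)) ` s = s"
      using f unfolding Aut_def by auto
    have "(\<lambda>(x, y). (inv f x, inv f y)) ` (\<lambda>(x, y). (f x, f y)) ` s = s" for s
      using bij by (force simp: bij_is_inj)
    with im have "(\<lambda>(x, y). (inv f x, inv f y)) ` s = s" if "s \<in> S" for s
      using that by metis
    with bij show ?thesis unfolding Aut_def by (simp add: bij_imp_bij_inv)
  qed
  moreover have "id \<in> Aut S" unfolding Aut_def by auto
  ultimately show ?thesis unfolding perm_group_def by (auto simp: Aut_def)
qed

text \<open>G lies in the automorphism group of its own scheme, and automorphisms preserve each
  orbital of G, so enlarging the group does not merge orbitals.\<close>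

lemma orbitals_Aut:
  assumes G: "perm_group G"
  shows "orbitals (Aut (orbitals G)) = orbitals G"
proof -
  let ?H = "Aut (orbitals G)"
  have sub: "G \<subseteq> ?H"
  proof
    fix g assume g: "g \<in> G"
    have "(\<lambda>(x, y). (g x, g y)) ` orbital G a b = orbital G a b" for a b
    proof
      show "(\<lambda>(x, y). (g x, g y)) ` orbital G a b \<subseteq> orbital G a b"
      proof
        fix p assume "p \<in> (\<lambda>(x, y). (g x, g y)) ` orbital G a b"
        then obtain f where "f \<in> G" "p = ((g \<circ> f) a, (g \<circ> f) b)" unfolding orbital_def by auto
        then show "p \<in> orbital G a b"
          unfolding orbital_def using perm_groupD(3)[OF G g] by blast
      qed
      show "orbital G a b \<subseteq> (\<lambda>(x, y). (g x, g y)) ` orbital G a b"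
      proof
        fix p assume "p \<in> orbital G a b"
        then obtain f where f: "f \<in> G" "p = (f a, f b)" unfolding orbital_def by blast
        have "(inv g (f a), inv g (f b)) \<in> orbital G a b"
          unfolding orbital_def using perm_groupD(3)[OF G perm_groupD(4)[OF G g] f(1)]
          by (intro CollectI exI[of _ "inv g \<circ> f"]) simp
        then have "(\<lambda>(x, y). (g x, g y)) (inv g (f a), inv g (f b)) \<in> (\<lambda>(x, y). (g x, g y)) ` orbital G a b"
          by (rule imageI)
        then show "p \<in> (\<lambda>(x, y). (g x, g y)) ` orbital G a b"
          by (simp add: f perm_groupD(6)[OF G g])
      qed
    qed
    then show "g \<in> ?H" unfolding Aut_def orbitals_eq using perm_groupD(1)[OF G g] by blast
  qed
  have "orbital ?H a b = orbital G a b" for a b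
  proof
    show "orbital G a b \<subseteq> orbital ?H a b" using sub unfolding orbital_def by blast
    show "orbital ?H a b \<subseteq> orbital G a b"
    proof
      fix p assume "p \<in> orbital ?H a b"
      then obtain f where f: "f \<in> ?H" "p = (f a, f b)" unfolding orbital_def by blast
      have "(\<lambda>(x, y). (f x, f y)) ` orbital G a b = orbital G a b"
        using f(1) unfolding Aut_def orbitals_eq by blast
      moreover have "p \<in> (\<lambda>(x, y). (f x, f y)) ` orbital G a b"
        using f(2) mem_orbital_self[OF G, of a b] by (auto intro!: image_eqI[of _ _ "(a, b)"])
      ultimately show "p \<in> orbital G a b" by simp
    qed
  qed
  then show ?thesis unfolding orbitals_eq by simp
qed

lemma transitive_if_Id_orbital:
  assumes G: "perm_group G" and "Id \<in> orbitals G"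
  shows "transitive_group G"
proof -
  have "\<exists>g\<in>G. g x = y" for x y
  proof -
    have "Id = orbital G x x" by (rule orbital_unique[OF G assms(2)]) simp
    then have "(y, y) \<in> orbital G x x" by blast
    then show ?thesis unfolding orbital_def by blast
  qed
  with G show ?thesis unfolding transitive_group_def by blast
qed

lemma valency_orbital: "valency (orbital G a x) a = card {y. \<exists>g\<in>G. g a = a \<and> g x = y}"
  unfolding valency_def orbital_def by (rule arg_cong[of _ _ card]) (auto simp: eq_commute)

lemma card_points_equivalenced:
  fixes S :: "('a::finite \<times> 'a) set set"
  assumes "is_scheme S" "\<forall>s\<in>S - {Id}. \<forall>a. valency s a = k"
  shows "CARD('a) = 1 + (card S - 1) * k"
proof -
  have S: "Id \<in> S" "\<Union>S = UNIV" "\<And>r s. r \<in> S \<Longrightarrow> s \<in> S \<Longrightarrow> r \<noteq> s \<Longrightarrow> r \<inter> s = {}"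
    using assms(1) unfolding is_scheme_def coherent_configuration_def by auto
  obtain a :: 'a where True by blast
  have "CARD('a) = card (\<Union>s\<in>S. {b. (a, b) \<in> s})"
    using S(2) by (intro arg_cong[of _ _ card]) auto
  also have "\<dots> = (\<Sum>s\<in>S. card {b. (a, b) \<in> s})"
    using S(3) by (intro card_UN_disjoint ballI impI finite) blast
  also have "\<dots> = card {b. (a, b) \<in> Id} + (\<Sum>s\<in>S - {Id}. card {b. (a, b) \<in> s})"
    using S(1) by (intro sum.remove) auto
  also have "(\<Sum>s\<in>S - {Id}. card {b. (a, b) \<in> s}) = (\<Sum>s\<in>S - {Id}. k)"
    using assms(2) unfolding valency_def by (intro sum.cong) auto
  finally show ?thesis using S(1) by (simp add: card_Diff_singleton)
qed

theorem theorem2p5: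
  fixes S :: "('a::finite \<times> 'a) set set" and k :: nat
  assumes "is_scheme S"
    and "schurian S"
    and "pseudocyclic S"
    and "\<forall>s\<in>S - {Id}. \<forall>a. valency s a = k"
    and "k > 1"
    and "card S > 2 * (k - 1)"
  shows "frobenius_scheme S \<and> frobenius_group (Aut S)"
proof -
  \<comment> \<open>Working with the full automorphism group yields both conclusions at once: it is
    itself the Frobenius group that realizes S.\<close>
  define G where "G = Aut S"
  have G: "perm_group G" unfolding G_def by (rule perm_group_Aut)
  have S: "S = orbitals G"
    using assms(2) orbitals_Aut unfolding schurian_def G_def by metis
  interpret group_scheme G S by unfold_locales (rule G, rule S)
  have Id: "Id \<in> S" using assms(1) unfolding is_scheme_def by blast
  have tr: "transitive_group G"
    using transitive_if_Id_orbital[OF G] Id S by simp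
  obtain c where c: "\<forall>P \<in> central_primitive_idempotents S - {J_normalized}. m_P S P / real (n_P S P) = c"
    using assms(3) unfolding pseudocyclic_def by blast
  have "frobenius_group G"
  proof (rule frobenius_if_constant_fixed_point_sums[OF tr assms(5)])
    fix a x :: 'a assume "a \<noteq> x"
    then have "orbital G a x \<in> S - {Id}"
      using mem_orbital_self[OF G, of a x] unfolding S orbitals_eq by auto
    then show "card {y. \<exists>g\<in>G. g a = a \<and> g x = y} = k"
      using assms(4) valency_orbital[of G a x] by auto
  next
    show "CARD('a) = 1 + (card S - 1) * k"
      by (rule card_points_equivalenced[OF assms(1,4)])
    show "2 * (k - 1) \<le> card S - 1" using assms(6) by simp
  qed (rule fixed_point_sum_constant[OF tr c])
  then show ?thesis
    using tr S unfolding frobenius_scheme_def scheme_of_group_def G_def by blast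
qed

end
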